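(* Let $T$ be an i.e.m. with no connection whose rotation number satisfies condition (a). Then the rotation number of $T$ also satisfies condition (a'). Consequently, every i.e.m. of Roth type (resp. restricted Roth type) is of absolute Roth type (resp. restricted absolute Roth type).
   Context: Interval exchange maps. Let $\mathcal A$ be an alphabet with $d\ge2$ letters. Combinatorial data is a pair $\pi=(\pi_t,\pi_b)$ of bijections $\mathcal A\to\{1,\dots,d\}$, always assumed irreducible: $\pi_t^{-1}(\{1,\dots,k\})\ne\pi_b^{-1}(\{1,\dots,k\})$ for $1\le k<d$. Given lengths $\lambda\in(0,\infty)^{\mathcal A}$, the interval exchange map (i.e.m.) $T=T_{\pi,\lambda}$ acts on an open interval $I=(u_0,u_d)$ of length $\sum_\alpha\lambda_\alpha$: it translates open intervals $I_\alpha=I_\alpha^t$ of length $\lambda_\alpha$, ordered from left to right according to $\pi_t$, onto intervals $I_\alpha^b$ of length $\lambda_\alpha$ ordered according to $\pi_b$ (extended by right-continuity). The points separating the $I_\alpha^t$ (resp. $I_\alpha^b$) are $u_1^t<\dots<u_{d-1}^t$ (resp. $u_1^b<\dots<u_{d-1}^b$). $T$ has no connection if there are no $i,j$ and $m\ge0$ with $T^m(u_j^b)=u_i^t$. $\Omega_\pi$ is the antisymmetric matrix with $\Omega_{\alpha\beta}=1$ if $\pi_t(\alpha)<\pi_t(\beta),\pi_b(\alpha)>\pi_b(\beta)$, $-1$ if $\pi_t(\alpha)>\pi_t(\beta),\pi_b(\alpha)<\pi_b(\beta)$, and $0$ otherwise. Its rank is $2g$; $H(\pi)\subset\mathbb R^{\mathcal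 A}$ denotes its image. Rauzy--Veech algorithm. Let $T$ have no connection, and let $\pi_t(\alpha_t)=\pi_b(\alpha_b)=d$. An elementary step replaces $T$ by its first return map to $(u_0,\max(u_{d-1}^t,u_{d-1}^b))$, again an i.e.m. with no connection labelled by $\mathcal A$. If $u^t_{d-1}<u^b_{d-1}$ the step is of top type, with winner $\alpha_t$ and loser $\alpha_b$; otherwise it is of bottom type, with winner $\alpha_b$ and loser $\alpha_t$. The matrix of a step is $B_\gamma=\mathrm{Id}+E_{\text{loser},\text{winner}}$. Iterating from $T=T^{(0)}$ gives i.e.m.'s $T^{(n)}$ ($n\ge0$) with combinatorial data $\pi^{(n)}$; the rotation number of $T$ is the infinite path $\gamma_1\star\gamma_2\star\cdots$ of successive steps, $\gamma_n:\pi^{(n-1)}\to\pi^{(n)}$, and $B(m,n)=B_{\gamma_n}\cdots B_{\gamma_{m+1}}$ for $m\le n$. A finite path is complete if every letter of $\mathcal A$ is the winner of at least one of its arrows. Norm: $\|B\|=\max_\alpha\sum_\beta|B_{\alpha\beta}|$. Conditions. $\Gamma(T)\simeq\mathbb R^{\mathcal A}$ is the space of functions constant on each $I_\alpha$; $B(m,n)$ acts from $\Gamma(T^{(m)})$ to $\Gamma(T^{(n)})$. $\Gamma_0(T)=\{\chi\in\Gamma(T):\int\chi=0\}$; $\Gamma_s(T)=\{\chi:\exists\sigma>0,\ \|B(0,n)\chi\|=O(\|B(0,n)\|^{-\sigma})\}$; $\Gamma_s(T^{(n)})=B(0,n)\Gamma_s(T)$. (a) With $\hat n_0=0$ and $\hat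 n_k$ the smallest $n>\hat n_{k-1}$ such that $\gamma_{\hat n_{k-1}+1}\star\cdots\star\gamma_n$ is complete: for all $\tau>0$ there is $C_\tau>0$ with $\|B(\hat n_{k-1},\hat n_k)\|\le C_\tau\|B(\hat n_0,\hat n_{k-1})\|^\tau$ for all $k>0$. (a') With $\mathcal C=(0,\infty)^{\mathcal A}$, $\mathcal C(\pi)=\mathcal C\cap H(\pi)$, $n_0=0$ and $n_k$ the smallest $n>n_{k-1}$ such that $\overline{B(n_{k-1},n)(\mathcal C(\pi^{(n_{k-1})}))}\subset\mathcal C(\pi^{(n)})\cup\{0\}$: for all $\tau>0$ there is $C_\tau>0$ with $\|B(n_{k-1},n_k)\|\le C_\tau\|B(n_0,n_{k-1})\|^\tau$ for all $k>0$. (b) There is $\theta>0$ with $\|B(0,n)_{|\Gamma_0(T)}\|=O(\|B(0,n)\|^{1-\theta})$. (c) For $0\le m\le n$ let $B_s(m,n):\Gamma_s(T^{(m)})\to\Gamma_s(T^{(n)})$ and $B_\flat(m,n):\Gamma(T^{(m)})/\Gamma_s(T^{(m)})\to\Gamma(T^{(n)})/\Gamma_s(T^{(n)})$ be induced by $B(m,n)$; for all $\tau>0$, $\|B_s(m,n)\|=O(\|B(0,n)\|^\tau)$ and $\|B_\flat(m,n)^{-1}\|=O(\|B(0,n)\|^\tau)$. (d) $\dim\Gamma_s(T)=g$. An i.e.m. with no connection is of Roth type if (a),(b),(c) hold and of restricted Roth type if (a)--(d) hold; it is of absolute Roth type if (a'),(b),(c) hold and of restricted absolute Roth type if (a'),(b),(c),(d)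 hold. *)

theory Defs
  imports "HOL-Analysis.Analysis" "HOL-Library.Landau_Symbols"
begin

section \<open>Combinatorial data\<close>

text \<open>
  The alphabet is the finite type \<open>'a\<close>, so \<open>d = CARD('a)\<close>. Combinatorial data is a pair
  \<open>(\<pi>\<^sub>t, \<pi>\<^sub>b)\<close> of maps from letters to positions \<open>1, \<dots>, d\<close>.
\<close>

type_synonym 'a comb_data = "('a \<Rightarrow> nat) \<times> ('a \<Rightarrow> nat)"

definition irreducible_data :: "('a::finite) comb_data \<Rightarrow> bool" where
  "irreducible_data \<pi> \<longleftrightarrow>
     (\<forall>k. 1 \<le> k \<and> k < CARD('a) \<longrightarrow> fst \<pi> -` {1..k} \<noteq> snd \<pi> -` {1..k})"

definition is_comb_data :: "('a::finite) comb_data \<Rightarrow> bool" where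
  "is_comb_data \<pi> \<longleftrightarrow>
     2 \<le> CARD('a) \<and>
     bij_betw (fst \<pi>) UNIV {1..CARD('a)} \<and> bij_betw (snd \<pi>) UNIV {1..CARD('a)} \<and>
     irreducible_data \<pi>"

definition alpha_t :: "('a::finite) comb_data \<Rightarrow> 'a" where
  "alpha_t \<pi> = (THE \<alpha>. fst \<pi> \<alpha> = CARD('a))"

definition alpha_b :: "('a::finite) comb_data \<Rightarrow> 'a" where
  "alpha_b \<pi> = (THE \<alpha>. snd \<pi> \<alpha> = CARD('a))"

definition Omega :: "('a::finite) comb_data \<Rightarrow> real^'a^'a" where
  "Omega \<pi> = (\<chi> \<alpha> \<beta>.
     if fst \<pi> \<alpha> < fst \<pi> \<beta> \<and> snd \<pi> \<alpha> > snd \<pi> \<beta> then 1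
     else if fst \<pi> \<alpha> > fst \<pi> \<beta> \<and> snd \<pi> \<alpha> < snd \<pi> \<beta> then -1
     else 0)"

definition genus :: "('a::finite) comb_data \<Rightarrow> nat" where
  "genus \<pi> = rank (Omega \<pi>) div 2"

definition H_space :: "('a::finite) comb_data \<Rightarrow> (real^'a) set" where
  "H_space \<pi> = range (\<lambda>v. Omega \<pi> *v v)"

definition positive_cone :: "(real^'a::finite) set" where
  "positive_cone = {v. \<forall>\<alpha>. v $ \<alpha> > 0}"

definition pos_cone_H :: "('a::finite) comb_data \<Rightarrow> (real^'a) set" where
  "pos_cone_H \<pi> = positive_cone \<inter> H_space \<pi>"


section \<open>Interval exchange maps\<close>

record ('a::finite) iem =
  data :: "'a comb_data"
  len :: "real^'a"
  u_left :: real

definition is_iem :: "('a::finite) iem \<Rightarrow> bool" where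
  "is_iem T \<longleftrightarrow> is_comb_data (data T) \<and> (\<forall>\<alpha>. len T $ \<alpha> > 0)"

definition u_right :: "('a::finite) iem \<Rightarrow> real" where
  "u_right T = u_left T + (\<Sum>\<alpha>\<in>UNIV. len T $ \<alpha>)"

definition u_t :: "('a::finite) iem \<Rightarrow> nat \<Rightarrow> real" where
  "u_t T k = u_left T + (\<Sum>\<alpha> | fst (data T) \<alpha> \<le> k. len T $ \<alpha>)"

definition u_b :: "('a::finite) iem \<Rightarrow> nat \<Rightarrow> real" where
  "u_b T k = u_left T + (\<Sum>\<alpha> | snd (data T) \<alpha> \<le> k. len T $ \<alpha>)"

definition left_t :: "('a::finite) iem \<Rightarrow> 'a \<Rightarrow> real" where
  "left_t T \<alpha> = u_left T + (\<Sum>\<beta> | fst (data T) \<beta> < fst (data T) \<alpha>. len T $ \<beta>)"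

definition left_b :: "('a::finite) iem \<Rightarrow> 'a \<Rightarrow> real" where
  "left_b T \<alpha> = u_left T + (\<Sum>\<beta> | snd (data T) \<beta> < snd (data T) \<alpha>. len T $ \<beta>)"

text \<open>
  The extension by right-continuity is built in by letting all intervals contain their left
  endpoint: the map becomes a bijection of \<open>[u\<^sub>0, u\<^sub>d)\<close>, and first return maps to \<open>[u\<^sub>0, u)\<close> are
  again right-continuous. Outside \<open>[u\<^sub>0, u\<^sub>d)\<close> the map is the identity, a value never used.
\<close>

definition I_t :: "('a::finite) iem \<Rightarrow> 'a \<Rightarrow> real set" where
  "I_t T \<alpha> = {left_t T \<alpha> ..< left_t T \<alpha> + len T $ \<alpha>}"

definition I_b :: "('a::finite) iem \<Rightarrow> 'a \<Rightarrow> real set" where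
  "I_b T \<alpha> = {left_b T \<alpha> ..< left_b T \<alpha> + len T $ \<alpha>}"

definition iem_map :: "('a::finite) iem \<Rightarrow> real \<Rightarrow> real" where
  "iem_map T x = x + (\<Sum>\<alpha>\<in>UNIV. (left_b T \<alpha> - left_t T \<alpha>) * indicator (I_t T \<alpha>) x)"

definition no_connection :: "('a::finite) iem \<Rightarrow> bool" where
  "no_connection T \<longleftrightarrow>
     \<not> (\<exists>i\<in>{1..<CARD('a)}. \<exists>j\<in>{1..<CARD('a)}. \<exists>m. (iem_map T ^^ m) (u_b T j) = u_t T i)"


section \<open>The Rauzy--Veech algorithm\<close>

definition first_return :: "(real \<Rightarrow> real) \<Rightarrow> real set \<Rightarrow> real \<Rightarrow> real" where
  "first_return f J x = (f ^^ (LEAST n. n > 0 \<and> (f ^^ n) x \<in> J)) x"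

datatype step_type = TopType | BottomType

definition type_of_step :: "('a::finite) iem \<Rightarrow> step_type" where
  "type_of_step T =
     (if u_t T (CARD('a) - 1) < u_b T (CARD('a) - 1) then TopType else BottomType)"

text \<open>
  \<open>T'\<close> is the first return map of \<open>T\<close> to \<open>[u\<^sub>0, max(u\<^sup>t\<^bsub>d-1\<^esub>, u\<^sup>b\<^bsub>d-1\<^esub>))\<close>. Its labelling by the alphabet is
  the usual one: in a step of top type every top interval keeps its name (and is cut at the new
  right endpoint), in a step of bottom type every bottom interval does. With it, a point of
  the new interval \<open>\<alpha>\<close> visits the old interval \<open>\<beta>\<close> exactly \<open>B\<^sub>\<alpha>\<^sub>\<beta>\<close> times before returning, with
  \<open>B = Id + E\<close> as in \<open>step_matrix\<close> below. If \<open>T\<close> has no connection, such a \<open>T'\<close> exists, is unique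
  and has no connection.
\<close>

definition is_elementary_step :: "('a::finite) iem \<Rightarrow> 'a iem \<Rightarrow> bool" where
  "is_elementary_step T T' \<longleftrightarrow>
     (let u = max (u_t T (CARD('a) - 1)) (u_b T (CARD('a) - 1)); J = {u_left T ..< u} in
        is_iem T' \<and> u_left T' = u_left T \<and> u_right T' = u \<and>
        (\<forall>x\<in>J. iem_map T' x = first_return (iem_map T) J x) \<and>
        (case type_of_step T of
           TopType \<Rightarrow> (\<forall>\<alpha>. I_t T' \<alpha> = I_t T \<alpha> \<inter> J)
         | BottomType \<Rightarrow> (\<forall>\<alpha>. I_b T' \<alpha> = I_b T \<alpha> \<inter> J)))"

definition elementary_step :: "('a::finite) iem \<Rightarrow> 'a iem" where
  "elementary_step T = (THE T'. is_elementary_step T T')"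

definition rv_iter :: "('a::finite) iem \<Rightarrow> nat \<Rightarrow> 'a iem" where
  "rv_iter T n = (elementary_step ^^ n) T"

record ('a::finite) arrow =
  source :: "'a comb_data"
  arrow_type :: step_type
  target :: "'a comb_data"

text \<open>
  Paths are indexed from \<open>0\<close>: \<open>\<gamma> n\<close> is the arrow \<open>\<gamma>\<^bsub>n+1\<^esub>\<close> from \<open>\<pi>\<^bsup>(n)\<^esup>\<close> to \<open>\<pi>\<^bsup>(n+1)\<^esup>\<close>. The segment
  from \<open>\<gamma>\<^bsub>m+1\<^esub>\<close> to \<open>\<gamma>\<^sub>n\<close> thus consists of the \<open>\<gamma> i\<close> with \<open>m \<le> i < n\<close>.
\<close>

type_synonym 'a path = "nat \<Rightarrow> 'a arrow"

definition rotation_number :: "('a::finite) iem \<Rightarrow> 'a path" where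
  "rotation_number T n =
     \<lparr>source = data (rv_iter T n), arrow_type = type_of_step (rv_iter T n),
      target = data (rv_iter T (Suc n))\<rparr>"

definition winner :: "('a::finite) arrow \<Rightarrow> 'a" where
  "winner a = (case arrow_type a of
     TopType \<Rightarrow> alpha_t (source a) | BottomType \<Rightarrow> alpha_b (source a))"

definition loser :: "('a::finite) arrow \<Rightarrow> 'a" where
  "loser a = (case arrow_type a of
     TopType \<Rightarrow> alpha_b (source a) | BottomType \<Rightarrow> alpha_t (source a))"

definition step_matrix :: "('a::finite) arrow \<Rightarrow> real^'a^'a" where
  "step_matrix a = mat 1 + (\<chi> \<alpha> \<beta>. if \<alpha> = loser a \<and> \<beta> = winner a then 1 else 0)"

text \<open>Only the values with \<open>m \<le> n\<close> are meaningful.\<close>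

fun B_mat :: "('a::finite) path \<Rightarrow> nat \<Rightarrow> nat \<Rightarrow> real^'a^'a" where
  "B_mat \<gamma> m 0 = mat 1"
| "B_mat \<gamma> m (Suc n) = (if m \<le> n then step_matrix (\<gamma> n) ** B_mat \<gamma> m n else mat 1)"

definition complete_segment :: "('a::finite) path \<Rightarrow> nat \<Rightarrow> nat \<Rightarrow> bool" where
  "complete_segment \<gamma> m n \<longleftrightarrow> (\<forall>\<alpha>. \<exists>i. m \<le> i \<and> i < n \<and> winner (\<gamma> i) = \<alpha>)"


section \<open>Norms\<close>

text \<open>
  Vectors carry the supremum norm \<open>infnorm\<close>, whose operator norm is \<open>mat_norm\<close>.
\<close>

definition mat_norm :: "real^'a^'a::finite \<Rightarrow> real" where
  "mat_norm B = Max (range (\<lambda>\<alpha>. \<Sum>\<beta>\<in>UNIV. \<bar>B $ \<alpha> $ \<beta>\<bar>))"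

definition restr_norm :: "real^'a^'a::finite \<Rightarrow> (real^'a) set \<Rightarrow> real" where
  "restr_norm B V = (SUP v\<in>{v\<in>V. infnorm v \<le> 1}. infnorm (B *v v))"

text \<open>The norm in the quotient by \<open>V\<close> of the class of \<open>w\<close>.\<close>

definition quot_norm :: "(real^'a::finite) set \<Rightarrow> real^'a \<Rightarrow> real" where
  "quot_norm V w = (INF v\<in>V. infnorm (w - v))"

text \<open>The operator norm of the map induced by \<open>B\<close> from the quotient by \<open>V\<close> to the quotient by \<open>W\<close>.\<close>

definition quot_op_norm :: "real^'a^'a::finite \<Rightarrow> (real^'a) set \<Rightarrow> (real^'a) set \<Rightarrow> real" where
  "quot_op_norm B V W = (SUP w\<in>{w. quot_norm V w \<le> 1}. quot_norm W (B *v w))"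


section \<open>Conditions on rotation numbers and Roth type\<close>

text \<open>
  The smallest numbers below exist if \<open>\<gamma>\<close> is the rotation number of an i.e.m. with no connection.
\<close>

fun complete_times :: "('a::finite) path \<Rightarrow> nat \<Rightarrow> nat" where
  "complete_times \<gamma> 0 = 0"
| "complete_times \<gamma> (Suc k) =
     (LEAST n. n > complete_times \<gamma> k \<and> complete_segment \<gamma> (complete_times \<gamma> k) n)"

definition condition_a :: "('a::finite) path \<Rightarrow> bool" where
  "condition_a \<gamma> \<longleftrightarrow>
     (\<forall>\<tau>>0. \<exists>C>0. \<forall>k>0.
        mat_norm (B_mat \<gamma> (complete_times \<gamma> (k - 1)) (complete_times \<gamma> k))
          \<le> C * mat_norm (B_mat \<gamma> (complete_times \<gamma> 0) (complete_times \<gamma> (k - 1))) powr \<tau>)"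

definition contracting_segment :: "('a::finite) path \<Rightarrow> nat \<Rightarrow> nat \<Rightarrow> bool" where
  "contracting_segment \<gamma> m n \<longleftrightarrow>
     closure ((\<lambda>v. B_mat \<gamma> m n *v v) ` pos_cone_H (source (\<gamma> m))) \<subseteq> pos_cone_H (source (\<gamma> n)) \<union> {0}"

fun contracting_times :: "('a::finite) path \<Rightarrow> nat \<Rightarrow> nat" where
  "contracting_times \<gamma> 0 = 0"
| "contracting_times \<gamma> (Suc k) =
     (LEAST n. n > contracting_times \<gamma> k \<and> contracting_segment \<gamma> (contracting_times \<gamma> k) n)"

definition condition_a' :: "('a::finite) path \<Rightarrow> bool" where
  "condition_a' \<gamma> \<longleftrightarrow>
     (\<forall>\<tau>>0. \<exists>C>0. \<forall>k>0.
        mat_norm (B_mat \<gamma> (contracting_times \<gamma> (k - 1)) (contracting_times \<gamma> k))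
          \<le> C * mat_norm (B_mat \<gamma> (contracting_times \<gamma> 0) (contracting_times \<gamma> (k - 1))) powr \<tau>)"

text \<open>
  \<open>\<Gamma>(T)\<close> is identified with \<open>\<real>\<^sup>\<A>\<close>; \<open>Gamma_fun T v\<close> is the piecewise constant function given by \<open>v\<close>.
\<close>

definition Gamma_fun :: "('a::finite) iem \<Rightarrow> real^'a \<Rightarrow> real \<Rightarrow> real" where
  "Gamma_fun T v x = (\<Sum>\<alpha>\<in>UNIV. v $ \<alpha> * indicator (I_t T \<alpha>) x)"

definition Gamma_0 :: "('a::finite) iem \<Rightarrow> (real^'a) set" where
  "Gamma_0 T = {v. integral {u_left T <..< u_right T} (Gamma_fun T v) = 0}"

definition Gamma_s :: "('a::finite) iem \<Rightarrow> (real^'a) set" where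
  "Gamma_s T = (let B = B_mat (rotation_number T) in
     {v. \<exists>\<sigma>>0. (\<lambda>n. infnorm (B 0 n *v v)) \<in> O(\<lambda>n. mat_norm (B 0 n) powr (- \<sigma>))})"

text \<open>\<open>\<Gamma>\<^sub>s(T\<^bsup>(n)\<^esup>)\<close>, by definition the image of \<open>\<Gamma>\<^sub>s(T)\<close>.\<close>

definition Gamma_s_iter :: "('a::finite) iem \<Rightarrow> nat \<Rightarrow> (real^'a) set" where
  "Gamma_s_iter T n = (\<lambda>v. B_mat (rotation_number T) 0 n *v v) ` Gamma_s T"

definition condition_b :: "('a::finite) iem \<Rightarrow> bool" where
  "condition_b T \<longleftrightarrow> (let B = B_mat (rotation_number T) in
     \<exists>\<theta>>0. (\<lambda>n. restr_norm (B 0 n) (Gamma_0 T)) \<in> O(\<lambda>n. mat_norm (B 0 n) powr (1 - \<theta>)))"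

text \<open>
  The bounds are uniform in \<open>0 \<le> m \<le> n\<close>. Since \<open>B(m,n)\<close> is invertible and maps \<open>\<Gamma>\<^sub>s(T\<^bsup>(m)\<^esup>)\<close> onto
  \<open>\<Gamma>\<^sub>s(T\<^bsup>(n)\<^esup>)\<close>, the inverse of the induced quotient map is induced by the inverse matrix.
\<close>

definition condition_c :: "('a::finite) iem \<Rightarrow> bool" where
  "condition_c T \<longleftrightarrow> (let B = B_mat (rotation_number T) in
     \<forall>\<tau>>0.
       (\<exists>C. \<forall>m n. m \<le> n \<longrightarrow>
          restr_norm (B m n) (Gamma_s_iter T m) \<le> C * mat_norm (B 0 n) powr \<tau>) \<and>
       (\<exists>C. \<forall>m n. m \<le> n \<longrightarrow>
          quot_op_norm (matrix_inv (B m n)) (Gamma_s_iter T n) (Gamma_s_iter T m)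
            \<le> C * mat_norm (B 0 n) powr \<tau>))"

definition condition_d :: "('a::finite) iem \<Rightarrow> bool" where
  "condition_d T \<longleftrightarrow> dim (Gamma_s T) = genus (data T)"

definition roth_type :: "('a::finite) iem \<Rightarrow> bool" where
  "roth_type T \<longleftrightarrow> is_iem T \<and> no_connection T \<and>
     condition_a (rotation_number T) \<and> condition_b T \<and> condition_c T"

definition restricted_roth_type :: "('a::finite) iem \<Rightarrow> bool" where
  "restricted_roth_type T \<longleftrightarrow> is_iem T \<and> no_connection T \<and>
     condition_a (rotation_number T) \<and> condition_b T \<and> condition_c T \<and> condition_d T"

definition absolute_roth_type :: "('a::finite) iem \<Rightarrow> bool" where
  "absolute_roth_type T \<longleftrightarrow> is_iem T \<and> no_connection T \<and>
     condition_a' (rotation_number T) \<and> condition_b T \<and> condition_c T"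

definition restricted_absolute_roth_type :: "('a::finite) iem \<Rightarrow> bool" where
  "restricted_absolute_roth_type T \<longleftrightarrow> is_iem T \<and> no_connection T \<and>
     condition_a' (rotation_number T) \<and> condition_b T \<and> condition_c T \<and> condition_d T"

end

theory Submission
  imports Defs
begin

text \<open>
  Condition (a) bounds the growth of the matrices between complete times, condition (a') between
  contracting times. Since the matrices \<open>B(m, n)\<close> are nonnegative and dominate the identity, their norms
  grow with the segment. So it suffices that a bounded number of complete segments always
  contains a contracting one: then the next contracting time is at most a bounded number of complete
  times ahead, and a product of boundedly many factors, each growing subpolynomially by (a),
  still grows subpolynomially.

  A segment is contracting as soon as its matrix is positive
  (\<open>contracting_segment_positive\<close>), because the matrices preserve the spaces \<open>H(\<pi>)\<close>, as follows from
  \<open>B \<Omega>\<^bsub>\<pi>\<^esub> B\<^sup>T = \<Omega>\<^bsub>\<pi>'\<^esub>\<close>. A concatenation of \<open>2 d\<close> complete segments has a positive matrix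
  (\<open>complete_segments_positive\<close>). The reason is that a winner takes part in the next step as
  well: if no letter of a set \<open>S\<close> ever beat a letter outside \<open>S\<close>, then the first win from outside would
  exclude the letters of \<open>S\<close> from winning for good.

  Two facts about the algorithm are needed for this to make sense. An elementary step must
  exist and be unique, and it must preserve the absence of connections. The induced map is therefore
  written down explicitly (\<open>rauzy_step\<close>) and shown to be the only one with the required properties.
  Moreover, complete times must exist, that is, each letter must win infinitely often
  (\<open>winner_infinitely_often\<close>). The letters that do not would end up as a common initial
  block of both rows, against irreducibility.

  The statements on Roth types follow because the two versions differ only in (a) and (a').
\<close>

section \<open>Rows of letters\<close>

text \<open>
  A row is one of the two orderings \<open>\<pi>\<^sub>t\<close>, \<open>\<pi>\<^sub>b\<close> of combinatorial data. Treating a single row in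
  isolation lets each geometric fact serve both the intervals \<open>I\<^sub>\<alpha>\<^sup>t\<close> and the intervals \<open>I\<^sub>\<alpha>\<^sup>b\<close>.
\<close>

abbreviation is_row :: "('a::finite \<Rightarrow> nat) \<Rightarrow> bool" where
  "is_row p \<equiv> bij_betw p UNIV {1..CARD('a)}"

definition offset :: "('a::finite \<Rightarrow> nat) \<Rightarrow> real^'a \<Rightarrow> 'a \<Rightarrow> real" where
  "offset p l \<alpha> = (\<Sum>\<beta> | p \<beta> < p \<alpha>. l $ \<beta>)"

lemma row_eq_iff: "is_row p \<Longrightarrow> p \<alpha> = p \<beta> \<longleftrightarrow> \<alpha> = \<beta>"
  by (auto simp: bij_betw_def inj_on_def)

lemma row_bounds:
  fixes p :: "'a::finite \<Rightarrow> nat"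
  assumes "is_row p"
  shows "1 \<le> p \<alpha>" "p \<alpha> \<le> CARD('a)"
  using assms by (auto simp: bij_betw_def)

lemma row_surj:
  fixes p :: "'a::finite \<Rightarrow> nat"
  assumes "is_row p" "1 \<le> k" "k \<le> CARD('a)"
  obtains \<alpha> where "p \<alpha> = k"
proof -
  have "k \<in> range p"
    using assms by (simp add: bij_betw_def)
  then show ?thesis
    using that by blast
qed

lemma row_card:
  fixes p :: "'a::finite \<Rightarrow> nat"
  assumes "is_row p"
  shows "card {\<beta>. p \<beta> \<le> p \<alpha>} = p \<alpha>"
proof -
  have "p ` {\<beta>. p \<beta> \<le> p \<alpha>} = {1..p \<alpha>}"
  proof (intro equalityI subsetI)
    fix k assume k: "k \<in> {1..p \<alpha>}"
    then obtain \<beta> where "p \<beta> = k"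
      using row_surj[OF assms, of k] row_bounds[OF assms, of \<alpha>] by auto
    then show "k \<in> p ` {\<beta>. p \<beta> \<le> p \<alpha>}"
      using k by auto
  qed (use row_bounds[OF assms] in auto)
  moreover have "inj_on p {\<beta>. p \<beta> \<le> p \<alpha>}"
    using assms by (auto simp: inj_on_def row_eq_iff)
  ultimately show ?thesis
    using card_image[of p "{\<beta>. p \<beta> \<le> p \<alpha>}"] by simp
qed

lemma offset_nonneg:
  assumes "\<And>\<gamma>. l $ \<gamma> > 0"
  shows "0 \<le> offset p l \<alpha>"
  unfolding offset_def by (intro sum_nonneg) (simp add: assms less_imp_le)

lemma offset_add_len:
  assumes "is_row p"
  shows "offset p l \<alpha> + l $ \<alpha> = (\<Sum>\<beta> | p \<beta> \<le> p \<alpha>. l $ \<beta>)"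
proof -
  have "{\<beta>. p \<beta> \<le> p \<alpha>} = insert \<alpha> {\<beta>. p \<beta> < p \<alpha>}"
    using row_eq_iff[OF assms] by (auto simp: le_less)
  then show ?thesis
    by (simp add: offset_def)
qed

lemma offset_step:
  assumes "is_row p" "\<And>\<gamma>. l $ \<gamma> > 0" "p \<alpha> < p \<beta>"
  shows "offset p l \<alpha> + l $ \<alpha> \<le> offset p l \<beta>"
  unfolding offset_add_len[OF assms(1)] unfolding offset_def
  by (intro sum_mono2) (use assms in \<open>auto simp: less_imp_le\<close>)

lemma offset_last:
  fixes p :: "'a::finite \<Rightarrow> nat"
  assumes "is_row p" "p \<alpha> = CARD('a)"
  shows "offset p l \<alpha> + l $ \<alpha> = (\<Sum>\<beta>\<in>UNIV. l $ \<beta>)"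
  unfolding offset_add_len[OF assms(1)] using row_bounds[OF assms(1)] assms(2) by simp

lemma offset_upper:
  assumes "is_row p" "\<And>\<gamma>. l $ \<gamma> > 0"
  shows "offset p l \<alpha> + l $ \<alpha> \<le> (\<Sum>\<beta>\<in>UNIV. l $ \<beta>)"
  unfolding offset_add_len[OF assms(1)]
  by (intro sum_mono2) (use assms in \<open>auto simp: less_imp_le\<close>)

text \<open>
  The letter whose interval contains \<open>x\<close> is the rightmost one whose interval starts at or before \<open>x\<close>.
\<close>

lemma offset_cover:
  fixes p :: "'a::finite \<Rightarrow> nat"
  assumes "is_row p" "\<And>\<gamma>. l $ \<gamma> > 0" "0 \<le> x" "x < (\<Sum>\<beta>\<in>UNIV. l $ \<beta>)"
  obtains \<alpha> where "offset p l \<alpha> \<le> x" "x < offset p l \<alpha> + l $ \<alpha>"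
proof -
  let ?S = "{\<alpha>. offset p l \<alpha> \<le> x}"
  obtain \<alpha>1 where "p \<alpha>1 = 1"
    using row_surj[OF assms(1), of 1] by (auto simp: Suc_le_eq)
  then have "{\<beta>. p \<beta> < p \<alpha>1} = {}"
    using row_bounds(1)[OF assms(1)] by (auto simp: Suc_le_eq)
  then have "\<alpha>1 \<in> ?S"
    using assms(3) by (simp add: offset_def)
  then have ne: "?S \<noteq> {}"
    by blast
  obtain \<alpha> where \<alpha>: "\<alpha> \<in> ?S" "\<And>\<beta>. \<beta> \<in> ?S \<Longrightarrow> p \<beta> \<le> p \<alpha>"
    using Max_in[of "p ` ?S"] Max_ge[of "p ` ?S"] ne by fastforce
  have "x < offset p l \<alpha> + l $ \<alpha>"
  proof (cases "p \<alpha> = CARD('a)")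
    case True
    then show ?thesis
      using offset_last[OF assms(1) True, of l] assms(4) by simp
  next
    case False
    then have "p \<alpha> < CARD('a)"
      using row_bounds(2)[OF assms(1), of \<alpha>] by simp
    then obtain \<beta> where \<beta>: "p \<beta> = Suc (p \<alpha>)"
      using row_surj[OF assms(1), of "Suc (p \<alpha>)"] by auto
    have "offset p l \<beta> = offset p l \<alpha> + l $ \<alpha>"
      unfolding offset_add_len[OF assms(1)] by (simp add: offset_def \<beta> less_Suc_eq_le)
    moreover have "\<not> offset p l \<beta> \<le> x"
      using \<alpha>(2)[of \<beta>] \<beta> by auto
    ultimately show ?thesis
      by simp
  qed
  then show ?thesis
    using that \<alpha>(1) by simp
qed

lemma offset_le_iff:
  assumes "is_row p" "\<And>\<gamma>. l $ \<gamma> > 0"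
  shows "offset p l \<alpha> \<le> offset p l \<beta> \<longleftrightarrow> p \<alpha> \<le> p \<beta>"
proof -
  have *: "offset p l \<gamma> < offset p l \<delta>" if "p \<gamma> < p \<delta>" for \<gamma> \<delta>
    using offset_step[OF assms that] assms(2)[of \<gamma>] by linarith
  show ?thesis
  proof (cases "p \<alpha> \<le> p \<beta>")
    case True
    then show ?thesis
      using *[of \<alpha> \<beta>] row_eq_iff[OF assms(1), of \<alpha> \<beta>] by (auto simp: le_less)
  next
    case False
    then show ?thesis
      using *[of \<beta> \<alpha>] by (simp add: not_le)
  qed
qed

text \<open>
  With positive lengths, the left endpoints are ordered as the letters are, and a row is determined by
  the order of its letters. This is why an elementary step has no choice in its combinatorial data.
\<close>

lemma offset_determines_row:
  assumes "is_row p" "is_row q" "\<And>\<gamma>. l $ \<gamma> > 0" "\<And>\<alpha>. offset p l \<alpha> = offset q l \<alpha>"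
  shows "p = q"
proof
  fix \<alpha>
  have "{\<beta>. p \<beta> \<le> p \<alpha>} = {\<beta>. q \<beta> \<le> q \<alpha>}"
    using offset_le_iff[OF assms(1,3)] offset_le_iff[OF assms(2,3)] assms(4) by auto
  then show "p \<alpha> = q \<alpha>"
    using row_card[OF assms(1)] row_card[OF assms(2)] by metis
qed

text \<open>
  The change of the loser's row in a Rauzy--Veech step: \<open>x\<close>, the last letter, is inserted directly
  behind \<open>w\<close>.
\<close>

definition move_after :: "('a \<Rightarrow> nat) \<Rightarrow> 'a \<Rightarrow> 'a \<Rightarrow> 'a \<Rightarrow> nat" where
  "move_after p w x \<beta> =
     (if p \<beta> \<le> p w then p \<beta> else if \<beta> = x then Suc (p w) else Suc (p \<beta>))"

definition shorten :: "real^'a::finite \<Rightarrow> 'a \<Rightarrow> 'a \<Rightarrow> real^'a" where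
  "shorten l w x = (\<chi> \<beta>. if \<beta> = w then l $ w - l $ x else l $ \<beta>)"

lemma is_row_move_after:
  fixes p :: "'a::finite \<Rightarrow> nat"
  assumes "is_row p" "p x = CARD('a)"
  shows "is_row (move_after p w x)"
proof -
  have lt: "p \<beta> < CARD('a)" if "\<beta> \<noteq> x" for \<beta>
    using that row_bounds(2)[OF assms(1), of \<beta>] row_eq_iff[OF assms(1), of \<beta> x] assms(2)
    by linarith
  have inj: "inj (move_after p w x)"
    using row_eq_iff[OF assms(1)]
    by (auto simp: inj_def move_after_def split: if_splits)
  have "range (move_after p w x) \<subseteq> {1..CARD('a)}"
  proof (rule image_subsetI)
    fix \<beta>
    show "move_after p w x \<beta> \<in> {1..CARD('a)}"
      using lt[of \<beta>] row_bounds[OF assms(1), of \<beta>] row_bounds[OF assms(1), of w] assms(2)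
      by (auto simp: move_after_def)
  qed
  moreover have "card (range (move_after p w x)) = CARD('a)"
    using inj by (simp add: card_image)
  ultimately have "range (move_after p w x) = {1..CARD('a)}"
    by (intro card_subset_eq) auto
  then show ?thesis
    using inj by (simp add: bij_betw_def)
qed

lemma sum_shorten:
  fixes l :: "real^'a::finite"
  shows "(\<Sum>\<beta>\<in>S. shorten l w x $ \<beta>) = (\<Sum>\<beta>\<in>S. l $ \<beta>) - (if w \<in> S then l $ x else 0)"
proof -
  have "shorten l w x $ \<beta> = l $ \<beta> - (if \<beta> = w then l $ x else 0)" for \<beta>
    by (simp add: shorten_def)
  then show ?thesis
    by (simp add: sum_subtractf)
qed

lemma offset_shorten_last:
  fixes q :: "'a::finite \<Rightarrow> nat"
  assumes "is_row q" "q w = CARD('a)"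
  shows "offset q (shorten l w x) \<alpha> = offset q l \<alpha>"
  using row_bounds(2)[OF assms(1), of \<alpha>] assms(2) by (simp add: offset_def sum_shorten)

text \<open>
  Behind \<open>w\<close>, inserting \<open>x\<close> adds the length that shortening \<open>w\<close> by the same amount removes. So no
  left endpoint moves except that of \<open>x\<close>, which lands at the start of the part cut off from \<open>w\<close>.
\<close>

lemma offset_move_after:
  fixes p :: "'a::finite \<Rightarrow> nat"
  assumes "is_row p" "p x = CARD('a)" "w \<noteq> x"
  shows "offset (move_after p w x) (shorten l w x) \<alpha> =
     (if \<alpha> = x then offset p l w + l $ w - l $ x else offset p l \<alpha>)"
proof -
  let ?p = "move_after p w x"
  have lt: "p \<beta> < p x" if "\<beta> \<noteq> x" for \<beta>
    using that row_bounds(2)[OF assms(1), of \<beta>] row_eq_iff[OF assms(1), of \<beta> x] assms(2)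
    by linarith
  have wx: "p w < p x"
    using lt assms(3) by blast
  consider "\<alpha> = x" | "\<alpha> \<noteq> x" "p \<alpha> \<le> p w" | "\<alpha> \<noteq> x" "p w < p \<alpha>"
    by linarith
  then show ?thesis
  proof cases
    case 1
    have "{\<beta>. ?p \<beta> < ?p \<alpha>} = {\<beta>. p \<beta> \<le> p w}"
      using wx 1 by (auto simp: move_after_def split: if_splits)
    then show ?thesis
      using 1 offset_add_len[OF assms(1), of l w] by (simp add: offset_def sum_shorten)
  next
    case 2
    have "{\<beta>. ?p \<beta> < ?p \<alpha>} = {\<beta>. p \<beta> < p \<alpha>}"
      using 2 by (auto simp: move_after_def split: if_splits)
    then show ?thesis
      using 2 by (simp add: offset_def sum_shorten)
  next
    case 3
    have "{\<beta>. ?p \<beta> < ?p \<alpha>} = insert x {\<beta>. p \<beta> < p \<alpha>}"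
      using 3 wx lt[OF 3(1)] by (auto simp: move_after_def split: if_splits)
    moreover have "x \<notin> {\<beta>. p \<beta> < p \<alpha>}"
      using lt[OF 3(1)] by simp
    ultimately show ?thesis
      using 3 wx assms(3) by (simp add: offset_def sum_shorten)
  qed
qed

section \<open>Interval exchange maps on their intervals\<close>

lemma is_iem_rows:
  fixes T :: "('a::finite) iem"
  assumes "is_iem T"
  shows "is_row (fst (data T))" "is_row (snd (data T))" "\<And>\<alpha>. len T $ \<alpha> > 0"
  using assms unfolding is_iem_def is_comb_data_def by blast+

lemma left_t_offset: "left_t T \<alpha> = u_left T + offset (fst (data T)) (len T) \<alpha>"
  unfolding left_t_def offset_def ..

lemma left_b_offset: "left_b T \<alpha> = u_left T + offset (snd (data T)) (len T) \<alpha>"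
  unfolding left_b_def offset_def ..

lemma left_t_step:
  assumes "is_iem T" "fst (data T) \<alpha> < fst (data T) \<beta>"
  shows "left_t T \<alpha> + len T $ \<alpha> \<le> left_t T \<beta>"
  using offset_step[OF is_iem_rows(1)[OF assms(1)] is_iem_rows(3)[OF assms(1)] assms(2)]
  by (simp add: left_t_offset)

lemma left_b_step:
  assumes "is_iem T" "snd (data T) \<alpha> < snd (data T) \<beta>"
  shows "left_b T \<alpha> + len T $ \<alpha> \<le> left_b T \<beta>"
  using offset_step[OF is_iem_rows(2)[OF assms(1)] is_iem_rows(3)[OF assms(1)] assms(2)]
  by (simp add: left_b_offset)

lemma left_t_bounds:
  assumes "is_iem T"
  shows "u_left T \<le> left_t T \<alpha>" "left_t T \<alpha> + len T $ \<alpha> \<le> u_right T"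
  using offset_nonneg[OF is_iem_rows(3)[OF assms], of "fst (data T)" \<alpha>]
    offset_upper[OF is_iem_rows(1)[OF assms] is_iem_rows(3)[OF assms], of \<alpha>]
  by (simp_all add: left_t_offset u_right_def)

lemma left_b_bounds:
  assumes "is_iem T"
  shows "u_left T \<le> left_b T \<alpha>" "left_b T \<alpha> + len T $ \<alpha> \<le> u_right T"
  using offset_nonneg[OF is_iem_rows(3)[OF assms], of "snd (data T)" \<alpha>]
    offset_upper[OF is_iem_rows(2)[OF assms] is_iem_rows(3)[OF assms], of \<alpha>]
  by (simp_all add: left_b_offset u_right_def)

lemma I_t_cover:
  assumes "is_iem T" "u_left T \<le> x" "x < u_right T"
  obtains \<alpha> where "x \<in> I_t T \<alpha>"
proof -
  have x: "0 \<le> x - u_left T" "x - u_left T < (\<Sum>\<beta>\<in>UNIV. len T $ \<beta>)"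
    using assms(2,3) by (auto simp: u_right_def)
  obtain \<alpha> where "offset (fst (data T)) (len T) \<alpha> \<le> x - u_left T"
    "x - u_left T < offset (fst (data T)) (len T) \<alpha> + len T $ \<alpha>"
    by (rule offset_cover[OF is_iem_rows(1)[OF assms(1)] is_iem_rows(3)[OF assms(1)] x])
  then show ?thesis
    using that[of \<alpha>] by (simp add: I_t_def left_t_offset)
qed

lemma I_t_unique:
  assumes "is_iem T" "x \<in> I_t T \<alpha>" "x \<in> I_t T \<beta>"
  shows "\<alpha> = \<beta>"
proof (rule ccontr)
  assume "\<alpha> \<noteq> \<beta>"
  then consider "fst (data T) \<alpha> < fst (data T) \<beta>" | "fst (data T) \<beta> < fst (data T) \<alpha>"
    using row_eq_iff[OF is_iem_rows(1)[OF assms(1)], of \<alpha> \<beta>] by linarith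
  then show False
    using left_t_step[OF assms(1), of \<alpha> \<beta>] left_t_step[OF assms(1), of \<beta> \<alpha>] assms(2,3)
    by cases (simp_all add: I_t_def)
qed

lemma I_b_unique:
  assumes "is_iem T" "x \<in> I_b T \<alpha>" "x \<in> I_b T \<beta>"
  shows "\<alpha> = \<beta>"
proof (rule ccontr)
  assume "\<alpha> \<noteq> \<beta>"
  then consider "snd (data T) \<alpha> < snd (data T) \<beta>" | "snd (data T) \<beta> < snd (data T) \<alpha>"
    using row_eq_iff[OF is_iem_rows(2)[OF assms(1)], of \<alpha> \<beta>] by linarith
  then show False
    using left_b_step[OF assms(1), of \<alpha> \<beta>] left_b_step[OF assms(1), of \<beta> \<alpha>] assms(2,3)
    by cases (simp_all add: I_b_def)
qed

lemma iem_map_translates: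
  assumes "is_iem T" "x \<in> I_t T \<alpha>"
  shows "iem_map T x = left_b T \<alpha> + (x - left_t T \<alpha>)"
proof -
  have "(left_b T \<beta> - left_t T \<beta>) * indicator (I_t T \<beta>) x =
      (if \<beta> = \<alpha> then left_b T \<beta> - left_t T \<beta> else 0)" for \<beta>
  proof (cases "\<beta> = \<alpha>")
    case False
    then have "x \<notin> I_t T \<beta>"
      using I_t_unique[OF assms(1), of x \<beta> \<alpha>] assms(2) by blast
    then show ?thesis
      using False by simp
  qed (use assms(2) in simp)
  then have "(\<Sum>\<beta>\<in>UNIV. (left_b T \<beta> - left_t T \<beta>) * indicator (I_t T \<beta>) x) =
      (\<Sum>\<beta>\<in>UNIV. if \<beta> = \<alpha> then left_b T \<beta> - left_t T \<beta> else 0)"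
    by (rule sum.cong[OF refl])
  also have "\<dots> = left_b T \<alpha> - left_t T \<alpha>"
    by simp
  finally show ?thesis
    unfolding iem_map_def by linarith
qed

lemma iem_map_in_I_b:
  assumes "is_iem T" "x \<in> I_t T \<alpha>"
  shows "iem_map T x \<in> I_b T \<alpha>"
  using assms(2) by (simp add: iem_map_translates[OF assms] I_t_def I_b_def)

lemma iem_map_range:
  assumes "is_iem T" "u_left T \<le> x" "x < u_right T"
  shows "u_left T \<le> iem_map T x" "iem_map T x < u_right T"
proof -
  obtain \<alpha> where "x \<in> I_t T \<alpha>"
    using I_t_cover[OF assms] .
  then have "iem_map T x \<in> I_b T \<alpha>"
    by (rule iem_map_in_I_b[OF assms(1)])
  then show "u_left T \<le> iem_map T x" "iem_map T x < u_right T"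
    using left_b_bounds[OF assms(1), of \<alpha>] unfolding I_b_def atLeastLessThan_iff by linarith+
qed

lemma I_t_inhabited: "is_iem T \<Longrightarrow> left_t T \<alpha> \<in> I_t T \<alpha>"
  by (simp add: I_t_def is_iem_rows(3))

lemma iem_map_left_t: "is_iem T \<Longrightarrow> iem_map T (left_t T \<alpha>) = left_b T \<alpha>"
  by (simp add: iem_map_translates[OF _ I_t_inhabited])

lemma I_t_subset: "is_iem T \<Longrightarrow> I_t T \<alpha> \<subseteq> {u_left T ..< u_right T}"
  using left_t_bounds(1)[of T \<alpha>] left_t_bounds(2)[of T \<alpha>]
  unfolding I_t_def by (intro subsetI) simp

text \<open>
  The top intervals can be recovered from the map and the bottom intervals. In a step of bottom type
  only the latter are prescribed.
\<close>

lemma I_t_eq_vimage: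
  assumes "is_iem T"
  shows "I_t T \<alpha> = {x \<in> {u_left T ..< u_right T}. iem_map T x \<in> I_b T \<alpha>}"
proof (intro equalityI subsetI)
  fix x assume "x \<in> {x \<in> {u_left T ..< u_right T}. iem_map T x \<in> I_b T \<alpha>}"
  then have x: "u_left T \<le> x" "x < u_right T" "iem_map T x \<in> I_b T \<alpha>"
    by auto
  obtain \<beta> where "x \<in> I_t T \<beta>"
    using I_t_cover[OF assms x(1,2)] .
  then show "x \<in> I_t T \<alpha>"
    using I_b_unique[OF assms x(3)] iem_map_in_I_b[OF assms] by metis
next
  fix x assume "x \<in> I_t T \<alpha>"
  then show "x \<in> {x \<in> {u_left T ..< u_right T}. iem_map T x \<in> I_b T \<alpha>}"
    using I_t_subset[OF assms, of \<alpha>] iem_map_in_I_b[OF assms] by blast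
qed

lemma iem_eqI:
  assumes "is_iem T" "is_iem T'" "u_left T = u_left T'" "\<And>\<alpha>. len T $ \<alpha> = len T' $ \<alpha>"
    "\<And>\<alpha>. left_t T \<alpha> = left_t T' \<alpha>" "\<And>\<alpha>. left_b T \<alpha> = left_b T' \<alpha>"
  shows "T = T'"
proof -
  have l: "len T = len T'"
    using assms(4) by (simp add: vec_eq_iff)
  have "fst (data T) = fst (data T')"
    using offset_determines_row[OF is_iem_rows(1)[OF assms(1)] is_iem_rows(1)[OF assms(2)]
        is_iem_rows(3)[OF assms(1)]] assms(3,5) l
    by (simp add: left_t_offset)
  moreover have "snd (data T) = snd (data T')"
    using offset_determines_row[OF is_iem_rows(2)[OF assms(1)] is_iem_rows(2)[OF assms(2)]
        is_iem_rows(3)[OF assms(1)]] assms(3,6) l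
    by (simp add: left_b_offset)
  ultimately show ?thesis
    using l assms(3) by (simp add: prod_eq_iff)
qed

lemma atLeastLessThan_eqD:
  fixes a b c d :: real
  assumes "{a..<b} = {c..<d}" "a < b"
  shows "a = c" "b = d"
  using assms by (auto simp: Ico_eq_Ico)

text \<open>
  The prescribed intervals and the prescribed map give all lengths and all left endpoints, and these
  determine both rows.
\<close>

lemma elementary_step_unique:
  fixes T :: "('a::finite) iem"
  assumes "is_elementary_step T T1" "is_elementary_step T T2"
  shows "T1 = T2"
proof -
  define J where
    "J = {u_left T ..< max (u_t T (CARD('a) - 1)) (u_b T (CARD('a) - 1))}"
  note e = assms[unfolded is_elementary_step_def Let_def, folded J_def]
  have iem: "is_iem T1" "is_iem T2"
    and ul1: "u_left T1 = u_left T" and ul2: "u_left T2 = u_left T"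
    and J: "{u_left T1 ..< u_right T1} = J" "{u_left T2 ..< u_right T2} = J"
    using e unfolding J_def by simp_all
  have map: "iem_map T1 x = iem_map T2 x" if "x \<in> J" for x
    using e that by simp
  have tops: "I_t T1 \<alpha> = I_t T2 \<alpha>" and lens: "len T1 $ \<alpha> = len T2 $ \<alpha>" for \<alpha>
  proof -
    have "I_t T1 \<alpha> = I_t T2 \<alpha> \<and> len T1 $ \<alpha> = len T2 $ \<alpha>"
    proof (cases "type_of_step T")
      case TopType
      then have eq: "I_t T1 \<alpha> = I_t T2 \<alpha>"
        using e by simp
      show ?thesis
        using eq atLeastLessThan_eqD[OF eq[unfolded I_t_def]] is_iem_rows(3)[OF iem(1), of \<alpha>]
        by simp
    next
      case BottomType
      then have eq: "I_b T1 \<alpha> = I_b T2 \<alpha>"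
        using e by simp
      have "I_t T1 \<alpha> = I_t T2 \<alpha>"
        unfolding I_t_eq_vimage[OF iem(1)] I_t_eq_vimage[OF iem(2)] J eq using map by auto
      then show ?thesis
        using atLeastLessThan_eqD[OF eq[unfolded I_b_def]] is_iem_rows(3)[OF iem(1), of \<alpha>]
        by simp
    qed
    then show "I_t T1 \<alpha> = I_t T2 \<alpha>" "len T1 $ \<alpha> = len T2 $ \<alpha>"
      by auto
  qed
  have lt: "left_t T1 \<alpha> = left_t T2 \<alpha>" for \<alpha>
    using atLeastLessThan_eqD(1)[OF tops[of \<alpha>, unfolded I_t_def]] is_iem_rows(3)[OF iem(1), of \<alpha>]
    by simp
  have lb: "left_b T1 \<alpha> = left_b T2 \<alpha>" for \<alpha>
  proof -
    have "left_t T1 \<alpha> \<in> J"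
      using I_t_inhabited[OF iem(1)] I_t_subset[OF iem(1)] J by blast
    then show ?thesis
      using map iem_map_left_t[OF iem(1)] iem_map_left_t[OF iem(2)] lt by metis
  qed
  show ?thesis
    by (rule iem_eqI) (use iem ul1 ul2 lens lt lb in auto)
qed

section \<open>The elementary step in closed form\<close>

text \<open>
  The winner and the loser of an arrow depend only on its type and its source. These versions speak
  of a step before any arrow has been formed.
\<close>

definition win :: "step_type \<Rightarrow> ('a::finite) comb_data \<Rightarrow> 'a" where
  "win s \<pi> = (case s of TopType \<Rightarrow> alpha_t \<pi> | BottomType \<Rightarrow> alpha_b \<pi>)"

definition lose :: "step_type \<Rightarrow> ('a::finite) comb_data \<Rightarrow> 'a" where
  "lose s \<pi> = (case s of TopType \<Rightarrow> alpha_b \<pi> | BottomType \<Rightarrow> alpha_t \<pi>)"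

definition rauzy_data :: "step_type \<Rightarrow> ('a::finite) comb_data \<Rightarrow> 'a comb_data" where
  "rauzy_data s \<pi> = (case s of
     TopType \<Rightarrow> (fst \<pi>, move_after (snd \<pi>) (alpha_t \<pi>) (alpha_b \<pi>))
   | BottomType \<Rightarrow> (move_after (fst \<pi>) (alpha_b \<pi>) (alpha_t \<pi>), snd \<pi>))"

definition rauzy_step :: "('a::finite) iem \<Rightarrow> 'a iem" where
  "rauzy_step T = (let s = type_of_step T; \<pi> = data T in
     \<lparr>data = rauzy_data s \<pi>, len = shorten (len T) (win s \<pi>) (lose s \<pi>), u_left = u_left T\<rparr>)"

lemma is_comb_data_rows:
  assumes "is_comb_data \<pi>"
  shows "is_row (fst \<pi>)" "is_row (snd \<pi>)"
  using assms unfolding is_comb_data_def by blast+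

lemma alpha_t_iff:
  fixes \<pi> :: "('a::finite) comb_data"
  assumes "is_comb_data \<pi>"
  shows "fst \<pi> \<alpha> = CARD('a) \<longleftrightarrow> \<alpha> = alpha_t \<pi>"
proof -
  note p = is_comb_data_rows(1)[OF assms]
  obtain \<beta> where \<beta>: "fst \<pi> \<beta> = CARD('a)"
    by (rule row_surj[OF p, of "CARD('a)"]) (simp_all add: Suc_le_eq)
  have "alpha_t \<pi> = \<beta>"
    unfolding alpha_t_def using \<beta> row_eq_iff[OF p] by (intro the_equality) metis+
  then show ?thesis
    using \<beta> row_eq_iff[OF p] by metis
qed

lemma alpha_b_iff:
  fixes \<pi> :: "('a::finite) comb_data"
  assumes "is_comb_data \<pi>"
  shows "snd \<pi> \<alpha> = CARD('a) \<longleftrightarrow> \<alpha> = alpha_b \<pi>"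
proof -
  note p = is_comb_data_rows(2)[OF assms]
  obtain \<beta> where \<beta>: "snd \<pi> \<beta> = CARD('a)"
    by (rule row_surj[OF p, of "CARD('a)"]) (simp_all add: Suc_le_eq)
  have "alpha_b \<pi> = \<beta>"
    unfolding alpha_b_def using \<beta> row_eq_iff[OF p] by (intro the_equality) metis+
  then show ?thesis
    using \<beta> row_eq_iff[OF p] by metis
qed

lemma fst_alpha_t:
  fixes \<pi> :: "('a::finite) comb_data"
  shows "is_comb_data \<pi> \<Longrightarrow> fst \<pi> (alpha_t \<pi>) = CARD('a)"
  by (simp add: alpha_t_iff)

lemma snd_alpha_b:
  fixes \<pi> :: "('a::finite) comb_data"
  shows "is_comb_data \<pi> \<Longrightarrow> snd \<pi> (alpha_b \<pi>) = CARD('a)"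
  by (simp add: alpha_b_iff)

lemma alpha_t_neq_alpha_b:
  fixes \<pi> :: "('a::finite) comb_data"
  assumes "is_comb_data \<pi>"
  shows "alpha_t \<pi> \<noteq> alpha_b \<pi>"
proof
  assume eq: "alpha_t \<pi> = alpha_b \<pi>"
  note rows = is_comb_data_rows[OF assms]
  have d: "2 \<le> CARD('a)" and irr: "irreducible_data \<pi>"
    using assms unfolding is_comb_data_def by blast+
  have f: "fst \<pi> \<beta> \<in> {1..CARD('a) - 1} \<longleftrightarrow> \<beta> \<noteq> alpha_t \<pi>" for \<beta>
    using row_bounds[OF rows(1), of \<beta>] alpha_t_iff[OF assms, of \<beta>] unfolding atLeastAtMost_iff by linarith
  have s: "snd \<pi> \<beta> \<in> {1..CARD('a) - 1} \<longleftrightarrow> \<beta> \<noteq> alpha_b \<pi>" for \<beta>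
    using row_bounds[OF rows(2), of \<beta>] alpha_b_iff[OF assms, of \<beta>] unfolding atLeastAtMost_iff by linarith
  have "fst \<pi> -` {1..CARD('a) - 1} = snd \<pi> -` {1..CARD('a) - 1}"
    by (intro set_eqI) (simp only: vimage_eq f s eq)
  moreover have "1 \<le> CARD('a) - 1" "CARD('a) - 1 < CARD('a)"
    using d by linarith+
  ultimately show False
    using irr unfolding irreducible_data_def by blast
qed

lemma move_after_vimage:
  assumes "k < p w"
  shows "move_after p w x -` {1..k} = p -` {1..k}"
  using assms by (auto simp: move_after_def split: if_splits)

text \<open>
  Irreducibility survives because the winner is last in the unchanged row: a common initial block of
  length \<open>k < d\<close> excludes it, so in the changed row the block lies before the winner, where nothing has
  moved, and it was already common before the step.
\<close>

lemma is_comb_data_rauzy_data: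
  fixes \<pi> :: "('a::finite) comb_data"
  assumes "is_comb_data \<pi>"
  shows "is_comb_data (rauzy_data s \<pi>)"
proof -
  let ?t = "alpha_t \<pi>" and ?b = "alpha_b \<pi>"
  note rows = is_comb_data_rows[OF assms]
  have d: "2 \<le> CARD('a)"
    and irr: "\<And>k. 1 \<le> k \<Longrightarrow> k < CARD('a) \<Longrightarrow> fst \<pi> -` {1..k} \<noteq> snd \<pi> -` {1..k}"
    using assms unfolding is_comb_data_def irreducible_data_def by blast+
  show ?thesis
  proof (cases s)
    case TopType
    let ?q = "move_after (snd \<pi>) ?t ?b"
    have "fst \<pi> -` {1..k} \<noteq> ?q -` {1..k}" if k: "1 \<le> k" "k < CARD('a)" for k
    proof
      assume eq: "fst \<pi> -` {1..k} = ?q -` {1..k}"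
      have "?t \<notin> fst \<pi> -` {1..k}"
        using k fst_alpha_t[OF assms] by simp
      then have "\<not> ?q ?t \<le> k"
        using eq row_bounds(1)[OF is_row_move_after[OF rows(2) snd_alpha_b[OF assms]], of ?t ?t]
        by auto
      then have "k < snd \<pi> ?t"
        by (simp add: move_after_def)
      then show False
        using irr[OF k] eq move_after_vimage by metis
    qed
    then show ?thesis
      using TopType d rows is_row_move_after[OF rows(2) snd_alpha_b[OF assms]]
      by (simp add: rauzy_data_def is_comb_data_def irreducible_data_def)
  next
    case BottomType
    let ?q = "move_after (fst \<pi>) ?b ?t"
    have "?q -` {1..k} \<noteq> snd \<pi> -` {1..k}" if k: "1 \<le> k" "k < CARD('a)" for k
    proof
      assume eq: "?q -` {1..k} = snd \<pi> -` {1..k}"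
      have "?b \<notin> snd \<pi> -` {1..k}"
        using k snd_alpha_b[OF assms] by simp
      then have "\<not> ?q ?b \<le> k"
        using eq row_bounds(1)[OF is_row_move_after[OF rows(1) fst_alpha_t[OF assms]], of ?b ?b]
        by auto
      then have "k < fst \<pi> ?b"
        by (simp add: move_after_def)
      then show False
        using irr[OF k] eq move_after_vimage by metis
    qed
    then show ?thesis
      using BottomType d rows is_row_move_after[OF rows(1) fst_alpha_t[OF assms]]
      by (simp add: rauzy_data_def is_comb_data_def irreducible_data_def)
  qed
qed

lemma is_iem_comb_data: "is_iem T \<Longrightarrow> is_comb_data (data T)"
  by (simp add: is_iem_def)

lemma left_t_eq_u_t:
  assumes "is_iem T"
  shows "left_t T \<alpha> = u_t T (fst (data T) \<alpha> - 1)"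
proof -
  have "fst (data T) \<beta> < fst (data T) \<alpha> \<longleftrightarrow> fst (data T) \<beta> \<le> fst (data T) \<alpha> - 1" for \<beta>
    using row_bounds(1)[OF is_iem_rows(1)[OF assms], of \<alpha>] by linarith
  then show ?thesis
    by (simp add: left_t_def u_t_def)
qed

lemma left_b_eq_u_b:
  assumes "is_iem T"
  shows "left_b T \<alpha> = u_b T (snd (data T) \<alpha> - 1)"
proof -
  have "snd (data T) \<beta> < snd (data T) \<alpha> \<longleftrightarrow> snd (data T) \<beta> \<le> snd (data T) \<alpha> - 1" for \<beta>
    using row_bounds(1)[OF is_iem_rows(2)[OF assms], of \<alpha>] by linarith
  then show ?thesis
    by (simp add: left_b_def u_b_def)
qed

lemma last_left_t:
  assumes "is_iem T"
  shows "left_t T (alpha_t (data T)) = u_right T - len T $ alpha_t (data T)"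
  using offset_last[OF is_iem_rows(1)[OF assms] fst_alpha_t[OF is_iem_comb_data[OF assms]], of "len T"]
  by (simp add: left_t_offset u_right_def)

lemma last_left_b:
  assumes "is_iem T"
  shows "left_b T (alpha_b (data T)) = u_right T - len T $ alpha_b (data T)"
  using offset_last[OF is_iem_rows(2)[OF assms] snd_alpha_b[OF is_iem_comb_data[OF assms]], of "len T"]
  by (simp add: left_b_offset u_right_def)

lemma u_last:
  fixes T :: "('a::finite) iem"
  assumes "is_iem T"
  shows "u_t T (CARD('a) - 1) = u_right T - len T $ alpha_t (data T)"
    "u_b T (CARD('a) - 1) = u_right T - len T $ alpha_b (data T)"
  using left_t_eq_u_t[OF assms, of "alpha_t (data T)"] last_left_t[OF assms]
    left_b_eq_u_b[OF assms, of "alpha_b (data T)"] last_left_b[OF assms]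
    fst_alpha_t[OF is_iem_comb_data[OF assms]] snd_alpha_b[OF is_iem_comb_data[OF assms]]
  by simp_all

lemma type_of_step_iff:
  assumes "is_iem T"
  shows "type_of_step T = TopType \<longleftrightarrow> len T $ alpha_b (data T) < len T $ alpha_t (data T)"
  unfolding type_of_step_def u_last[OF assms] by simp

text \<open>
  The singularities \<open>u\<^sub>i\<^sup>t\<close> and \<open>u\<^sub>j\<^sup>b\<close> are the left endpoints of the letters that are not first in their
  row. Indexing them by letters is convenient since a step keeps the letters and not the indices.
\<close>

lemma no_connection_iff:
  fixes T :: "('a::finite) iem"
  assumes "is_iem T"
  shows "no_connection T \<longleftrightarrow> (\<forall>\<alpha> \<beta> m. 1 < snd (data T) \<alpha> \<longrightarrow> 1 < fst (data T) \<beta> \<longrightarrow>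
     (iem_map T ^^ m) (left_b T \<alpha>) \<noteq> left_t T \<beta>)"
    (is "_ = ?R")
proof
  assume nc: "no_connection T"
  show ?R
  proof (intro allI impI)
    fix \<alpha> \<beta> m assume "1 < snd (data T) \<alpha>" "1 < fst (data T) \<beta>"
    then have "snd (data T) \<alpha> - 1 \<in> {1..<CARD('a)}" "fst (data T) \<beta> - 1 \<in> {1..<CARD('a)}"
      using row_bounds(2)[OF is_iem_rows(1)[OF assms], of \<beta>]
        row_bounds(2)[OF is_iem_rows(2)[OF assms], of \<alpha>] by auto
    then show "(iem_map T ^^ m) (left_b T \<alpha>) \<noteq> left_t T \<beta>"
      using nc unfolding no_connection_def left_t_eq_u_t[OF assms] left_b_eq_u_b[OF assms] by blast
  qed
next
  assume R: ?R
  show "no_connection T"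
    unfolding no_connection_def
  proof (safe)
    fix i j m assume ij: "i \<in> {1..<CARD('a)}" "j \<in> {1..<CARD('a)}"
      and eq: "(iem_map T ^^ m) (u_b T j) = u_t T i"
    obtain \<beta> where \<beta>: "fst (data T) \<beta> = Suc i"
      by (rule row_surj[OF is_iem_rows(1)[OF assms], of "Suc i"]) (use ij in auto)
    obtain \<alpha> where \<alpha>: "snd (data T) \<alpha> = Suc j"
      by (rule row_surj[OF is_iem_rows(2)[OF assms], of "Suc j"]) (use ij in auto)
    show False
      using R[rule_format, of \<alpha> \<beta> m] eq ij \<alpha> \<beta>
      by (simp add: left_t_eq_u_t[OF assms] left_b_eq_u_b[OF assms])
  qed
qed

lemma no_connection_last_lengths:
  assumes "is_iem T" "no_connection T"
  shows "len T $ alpha_t (data T) \<noteq> len T $ alpha_b (data T)"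
proof
  assume eq: "len T $ alpha_t (data T) = len T $ alpha_b (data T)"
  note c = is_iem_comb_data[OF assms(1)]
  have "2 \<le> CARD('a)"
    using c unfolding is_comb_data_def by blast
  then have "(iem_map T ^^ 0) (left_b T (alpha_b (data T))) \<noteq> left_t T (alpha_t (data T))"
    using assms(2)[unfolded no_connection_iff[OF assms(1)], rule_format,
        of "alpha_b (data T)" "alpha_t (data T)" 0] fst_alpha_t[OF c] snd_alpha_b[OF c]
    by simp
  then show False
    using eq by (simp add: last_left_t[OF assms(1)] last_left_b[OF assms(1)])
qed

lemma lose_less_win:
  assumes "is_iem T" "no_connection T"
  shows "len T $ lose (type_of_step T) (data T) < len T $ win (type_of_step T) (data T)"
  using no_connection_last_lengths[OF assms] type_of_step_iff[OF assms(1)]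
  by (cases "type_of_step T") (auto simp: win_def lose_def)

lemma win_neq_lose: "is_comb_data \<pi> \<Longrightarrow> win s \<pi> \<noteq> lose s \<pi>"
  using alpha_t_neq_alpha_b[of \<pi>] by (cases s) (auto simp: win_def lose_def)

lemma rauzy_step_simps:
  "data (rauzy_step T) = rauzy_data (type_of_step T) (data T)"
  "len (rauzy_step T) =
     shorten (len T) (win (type_of_step T) (data T)) (lose (type_of_step T) (data T))"
  "u_left (rauzy_step T) = u_left T"
  by (simp_all add: rauzy_step_def Let_def)

lemma u_right_rauzy_step:
  "u_right (rauzy_step T) = u_right T - len T $ lose (type_of_step T) (data T)"
  by (simp add: u_right_def rauzy_step_simps sum_shorten)

lemma is_iem_rauzy_step:
  assumes "is_iem T" "no_connection T"
  shows "is_iem (rauzy_step T)"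
  unfolding is_iem_def rauzy_step_simps
  using is_comb_data_rauzy_data[OF is_iem_comb_data[OF assms(1)]] lose_less_win[OF assms]
    is_iem_rows(3)[OF assms(1)]
  by (simp add: shorten_def)

lemma left_rauzy_step_top:
  assumes "is_iem T" "type_of_step T = TopType"
  defines "t \<equiv> alpha_t (data T)" and "b \<equiv> alpha_b (data T)"
  shows "left_t (rauzy_step T) \<alpha> = left_t T \<alpha>"
    "left_b (rauzy_step T) \<alpha> =
       (if \<alpha> = b then left_b T t + len T $ t - len T $ b else left_b T \<alpha>)"
proof -
  note c = is_iem_comb_data[OF assms(1)] and rows = is_iem_rows[OF assms(1)]
  show "left_t (rauzy_step T) \<alpha> = left_t T \<alpha>"
    using offset_shorten_last[OF rows(1) fst_alpha_t[OF c]] assms(2)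
    by (simp add: left_t_offset rauzy_step_simps rauzy_data_def win_def lose_def)
  show "left_b (rauzy_step T) \<alpha> =
       (if \<alpha> = b then left_b T t + len T $ t - len T $ b else left_b T \<alpha>)"
    using offset_move_after[OF rows(2) snd_alpha_b[OF c] alpha_t_neq_alpha_b[OF c], of "len T" \<alpha>]
      assms(2)
    by (simp add: left_b_offset rauzy_step_simps rauzy_data_def win_def lose_def t_def b_def)
qed

lemma left_rauzy_step_bottom:
  assumes "is_iem T" "type_of_step T = BottomType"
  defines "t \<equiv> alpha_t (data T)" and "b \<equiv> alpha_b (data T)"
  shows "left_b (rauzy_step T) \<alpha> = left_b T \<alpha>"
    "left_t (rauzy_step T) \<alpha> =
       (if \<alpha> = t then left_t T b + len T $ b - len T $ t else left_t T \<alpha>)"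
proof -
  note c = is_iem_comb_data[OF assms(1)] and rows = is_iem_rows[OF assms(1)]
  show "left_b (rauzy_step T) \<alpha> = left_b T \<alpha>"
    using offset_shorten_last[OF rows(2) snd_alpha_b[OF c]] assms(2)
    by (simp add: left_b_offset rauzy_step_simps rauzy_data_def win_def lose_def)
  show "left_t (rauzy_step T) \<alpha> =
       (if \<alpha> = t then left_t T b + len T $ b - len T $ t else left_t T \<alpha>)"
    using offset_move_after[OF rows(1) fst_alpha_t[OF c] alpha_t_neq_alpha_b[OF c, symmetric],
        of "len T" \<alpha>] assms(2)
    by (simp add: left_t_offset rauzy_step_simps rauzy_data_def win_def lose_def t_def b_def)
qed

section \<open>First returns and the absence of connections\<close>

text \<open>
  In an elementary step, every point returns after one or two iterations.
\<close>

lemma first_return_eqI: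
  assumes "f x = y \<or> f x \<notin> J \<and> f (f x) = y" "y \<in> J"
  shows "first_return f J x = y"
proof (cases "f x \<in> J")
  case True
  have "(LEAST n. n > 0 \<and> (f ^^ n) x \<in> J) = 1"
    by (rule Least_equality) (use True in auto)
  then show ?thesis
    using assms True by (simp add: first_return_def)
next
  case False
  then have ffx: "f (f x) = y"
    using assms by blast
  have "(LEAST n. n > 0 \<and> (f ^^ n) x \<in> J) = 2"
  proof (rule Least_equality)
    show "(2::nat) > 0 \<and> (f ^^ 2) x \<in> J"
      using ffx assms(2) by (simp add: numeral_2_eq_2)
  next
    fix n assume n: "n > 0 \<and> (f ^^ n) x \<in> J"
    then have "n \<noteq> 1"
      using False by auto
    then show "2 \<le> n"
      using n by linarith
  qed
  then show ?thesis
    using ffx by (simp add: first_return_def numeral_2_eq_2)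
qed

text \<open>
  Points of the loser are the ones that return late. In a step of top type they are mapped to the
  removed interval at the right end, which lies in the winner's top interval. In a step of bottom
  type they are the part cut off from the winner's top interval, which is mapped onto the removed
  interval, the loser's old top interval. In all other cases the old and the new map agree.
\<close>

lemma iem_map_rauzy_step:
  fixes T :: "('a::finite) iem"
  assumes "is_iem T" "no_connection T"
    and x: "u_left T \<le> x" "x < u_right (rauzy_step T)"
  defines "J \<equiv> {u_left T ..< u_right (rauzy_step T)}"
  shows "iem_map T x = iem_map (rauzy_step T) x \<or>
    iem_map T x \<notin> J \<and> iem_map T (iem_map T x) = iem_map (rauzy_step T) x"
proof -
  let ?T' = "rauzy_step T"
  let ?t = "alpha_t (data T)" and ?b = "alpha_b (data T)"
  note iem = assms(1) and iem' = is_iem_rauzy_step[OF assms(1,2)]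
  note len' = rauzy_step_simps(2)[of T]
  note llt = last_left_t[OF iem] and llb = last_left_b[OF iem]
  note tb = alpha_t_neq_alpha_b[OF is_iem_comb_data[OF iem]]
  obtain \<alpha> where \<alpha>: "x \<in> I_t ?T' \<alpha>"
    by (rule I_t_cover[OF iem', of x]) (use x in \<open>simp_all add: rauzy_step_simps\<close>)
  note T'x = iem_map_translates[OF iem' \<alpha>]
  show ?thesis
  proof (cases "type_of_step T")
    case TopType
    note l = left_rauzy_step_top[OF iem TopType]
    have lenT': "len ?T' $ \<beta> = (if \<beta> = ?t then len T $ ?t - len T $ ?b else len T $ \<beta>)" for \<beta>
      unfolding len' by (simp add: TopType win_def lose_def shorten_def)
    have lt: "len T $ ?b < len T $ ?t"
      using TopType type_of_step_iff[OF iem] by blast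
    have uJ: "u_right ?T' = u_right T - len T $ ?b"
      by (simp add: u_right_rauzy_step TopType lose_def)
    have \<alpha>T: "x \<in> I_t T \<alpha>"
      using \<alpha> is_iem_rows(3)[OF iem, of ?b] by (auto simp: I_t_def l lenT' split: if_splits)
    note Tx = iem_map_translates[OF iem \<alpha>T]
    show ?thesis
    proof (cases "\<alpha> = ?b")
      case False
      then show ?thesis
        using Tx T'x by (simp add: l)
    next
      case True
      have bounds: "left_t T ?b \<le> x" "x < left_t T ?b + len T $ ?b"
        using \<alpha>T True by (simp_all add: I_t_def)
      have "iem_map T x \<in> I_t T ?t"
        using bounds lt unfolding Tx True llb by (simp add: I_t_def llt)
      note TTx = iem_map_translates[OF iem this]
      have "iem_map T x \<notin> J"
        using bounds unfolding Tx True llb J_def uJ by simp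
      moreover have "iem_map T (iem_map T x) = iem_map ?T' x"
        using TTx Tx T'x llt llb unfolding l True if_P[OF refl] by linarith
      ultimately show ?thesis
        by blast
    qed
  next
    case BottomType
    note l = left_rauzy_step_bottom[OF iem BottomType]
    have lenT': "len ?T' $ \<beta> = (if \<beta> = ?b then len T $ ?b - len T $ ?t else len T $ \<beta>)" for \<beta>
      unfolding len' by (simp add: BottomType win_def lose_def shorten_def)
    have lt: "len T $ ?t < len T $ ?b"
      using lose_less_win[OF assms(1,2)] by (simp add: BottomType win_def lose_def)
    have uJ: "u_right ?T' = u_right T - len T $ ?t"
      by (simp add: u_right_rauzy_step BottomType lose_def)
    show ?thesis
    proof (cases "\<alpha> = ?t")
      case False
      then have \<alpha>T: "x \<in> I_t T \<alpha>"
        using \<alpha> is_iem_rows(3)[OF iem, of ?t] by (auto simp: I_t_def l lenT' split: if_splits)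
      show ?thesis
        using False T'x iem_map_translates[OF iem \<alpha>T] by (simp add: l)
    next
      case True
      have bounds: "left_t T ?b + len T $ ?b - len T $ ?t \<le> x" "x < left_t T ?b + len T $ ?b"
        using \<alpha> True tb by (simp_all add: I_t_def l lenT')
      then have "x \<in> I_t T ?b"
        using lt by (simp add: I_t_def)
      note Tx = iem_map_translates[OF iem this]
      have "iem_map T x \<in> I_t T ?t"
        using bounds unfolding Tx llb by (simp add: I_t_def llt)
      note TTx = iem_map_translates[OF iem this]
      have "iem_map T x \<notin> J"
        using bounds unfolding Tx llb J_def uJ by simp
      moreover have "iem_map T (iem_map T x) = iem_map ?T' x"
        using TTx Tx T'x llt llb unfolding l True if_P[OF refl] by linarith
      ultimately show ?thesis
        by blast
    qed
  qed
qed

lemma iem_map_rauzy_step_in_J: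
  assumes "is_iem T" "no_connection T"
    and "x \<in> {u_left T ..< u_right (rauzy_step T)}"
  shows "iem_map (rauzy_step T) x \<in> {u_left T ..< u_right (rauzy_step T)}"
  using iem_map_range[OF is_iem_rauzy_step[OF assms(1,2)], of x] assms(3)
  by (simp add: rauzy_step_simps)

lemma is_elementary_step_rauzy_step:
  fixes T :: "('a::finite) iem"
  assumes "is_iem T" "no_connection T"
  shows "is_elementary_step T (rauzy_step T)"
proof -
  let ?T' = "rauzy_step T"
  let ?t = "alpha_t (data T)" and ?b = "alpha_b (data T)"
  define J where "J = {u_left T ..< u_right ?T'}"
  note iem = assms(1) and iem' = is_iem_rauzy_step[OF assms]
  note llt = last_left_t[OF iem] and llb = last_left_b[OF iem]
  note len' = rauzy_step_simps(2)[of T]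
  have u: "max (u_t T (CARD('a) - 1)) (u_b T (CARD('a) - 1)) = u_right ?T'"
    unfolding u_last[OF iem] u_right_rauzy_step using lose_less_win[OF assms]
    by (cases "type_of_step T") (simp_all add: win_def lose_def)
  have return: "iem_map ?T' x = first_return (iem_map T) J x" if "x \<in> J" for x
    using first_return_eqI[of "iem_map T" x "iem_map ?T' x" J]
      iem_map_rauzy_step[OF assms, of x] iem_map_rauzy_step_in_J[OF assms, of x] that
    by (simp add: J_def)
  have top: "I_t ?T' \<alpha> = I_t T \<alpha> \<inter> J" if s: "type_of_step T = TopType" for \<alpha>
  proof -
    have lt: "len T $ ?b < len T $ ?t"
      using s type_of_step_iff[OF iem] by blast
    have uJ: "u_right ?T' = u_right T - len T $ ?b"
      by (simp add: u_right_rauzy_step s lose_def)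
    note l = left_rauzy_step_top[OF iem s]
    show ?thesis
    proof (cases "\<alpha> = ?t")
      case True
      have "len ?T' $ \<alpha> = len T $ ?t - len T $ ?b"
        unfolding len' by (simp add: s win_def lose_def shorten_def True)
      then show ?thesis
        using left_t_bounds(1)[OF iem, of ?t] is_iem_rows(3)[OF iem, of ?b]
        by (auto simp: I_t_def J_def l uJ True llt)
    next
      case False
      then have "fst (data T) \<alpha> < fst (data T) ?t"
        using row_bounds(2)[OF is_iem_rows(1)[OF iem], of \<alpha>] fst_alpha_t[OF is_iem_comb_data[OF iem]]
          alpha_t_iff[OF is_iem_comb_data[OF iem], of \<alpha>] by linarith
      then have "left_t T \<alpha> + len T $ \<alpha> \<le> u_right T - len T $ ?b"
        using left_t_step[OF iem, of \<alpha> ?t] lt llt by linarith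
      moreover have "len ?T' $ \<alpha> = len T $ \<alpha>"
        unfolding len' using False by (simp add: s win_def lose_def shorten_def)
      ultimately show ?thesis
        using left_t_bounds(1)[OF iem, of \<alpha>] by (auto simp: I_t_def J_def l uJ)
    qed
  qed
  have bottom: "I_b ?T' \<alpha> = I_b T \<alpha> \<inter> J" if s: "type_of_step T = BottomType" for \<alpha>
  proof -
    have lt: "len T $ ?t < len T $ ?b"
      using lose_less_win[OF assms] by (simp add: s win_def lose_def)
    have uJ: "u_right ?T' = u_right T - len T $ ?t"
      by (simp add: u_right_rauzy_step s lose_def)
    note l = left_rauzy_step_bottom[OF iem s]
    show ?thesis
    proof (cases "\<alpha> = ?b")
      case True
      have "len ?T' $ \<alpha> = len T $ ?b - len T $ ?t"
        unfolding len' by (simp add: s win_def lose_def shorten_def True)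
      then show ?thesis
        using left_b_bounds(1)[OF iem, of ?b] is_iem_rows(3)[OF iem, of ?t]
        by (auto simp: I_b_def J_def l uJ True llb)
    next
      case False
      then have "snd (data T) \<alpha> < snd (data T) ?b"
        using row_bounds(2)[OF is_iem_rows(2)[OF iem], of \<alpha>] snd_alpha_b[OF is_iem_comb_data[OF iem]]
          alpha_b_iff[OF is_iem_comb_data[OF iem], of \<alpha>] by linarith
      then have "left_b T \<alpha> + len T $ \<alpha> \<le> u_right T - len T $ ?t"
        using left_b_step[OF iem, of \<alpha> ?b] lt llb by linarith
      moreover have "len ?T' $ \<alpha> = len T $ \<alpha>"
        unfolding len' using False by (simp add: s win_def lose_def shorten_def)
      ultimately show ?thesis
        using left_b_bounds(1)[OF iem, of \<alpha>] by (auto simp: I_b_def J_def l uJ)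
    qed
  qed
  show ?thesis
    unfolding is_elementary_step_def Let_def u J_def[symmetric]
    using iem' return top bottom by (simp add: rauzy_step_simps split: step_type.split)
qed

lemma elementary_step_eq:
  assumes "is_iem T" "no_connection T"
  shows "elementary_step T = rauzy_step T"
  unfolding elementary_step_def
  using is_elementary_step_rauzy_step[OF assms] elementary_step_unique by (intro the_equality) blast+

text \<open>
  Orbits of the new map are contained in orbits of the old one, so a connection of the new map yields
  one of the old map.
\<close>

lemma funpow_rauzy_step:
  assumes "is_iem T" "no_connection T" "x \<in> {u_left T ..< u_right (rauzy_step T)}"
  shows "(iem_map (rauzy_step T) ^^ m) x \<in> {u_left T ..< u_right (rauzy_step T)} \<and>
    (\<exists>k. (iem_map (rauzy_step T) ^^ m) x = (iem_map T ^^ k) x)"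
proof (induction m)
  case 0
  have "(iem_map (rauzy_step T) ^^ 0) x = (iem_map T ^^ 0) x"
    by simp
  then show ?case
    using assms(3) by (metis funpow_0)
next
  case (Suc m)
  let ?y = "(iem_map (rauzy_step T) ^^ m) x"
  obtain k where k: "?y = (iem_map T ^^ k) x" and y: "?y \<in> {u_left T ..< u_right (rauzy_step T)}"
    using Suc by blast
  have "iem_map (rauzy_step T) ?y = iem_map T ?y \<or>
      iem_map (rauzy_step T) ?y = iem_map T (iem_map T ?y)"
    using iem_map_rauzy_step[OF assms(1,2), of ?y] y by auto
  then have "\<exists>k. iem_map (rauzy_step T) ?y = (iem_map T ^^ k) x"
  proof
    assume "iem_map (rauzy_step T) ?y = iem_map T ?y"
    then show ?thesis
      unfolding k by (intro exI[of _ "Suc k"]) simp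
  next
    assume "iem_map (rauzy_step T) ?y = iem_map T (iem_map T ?y)"
    then show ?thesis
      unfolding k by (intro exI[of _ "Suc (Suc k)"]) simp
  qed
  then show ?case
    using iem_map_rauzy_step_in_J[OF assms(1,2) y] by simp
qed

text \<open>
  All singularities of the new map are singularities of the old one, except that the new left endpoint
  of the loser is the image under \<open>T\<close> of the old one (top type), or is mapped to it by \<open>T\<close> (bottom
  type). Either way a connection for the new map extends to one for the old map.
\<close>

lemma no_connection_rauzy_step:
  fixes T :: "('a::finite) iem"
  assumes "is_iem T" "no_connection T"
  shows "no_connection (rauzy_step T)"
  unfolding no_connection_iff[OF is_iem_rauzy_step[OF assms]]
proof (intro allI impI notI)
  fix \<alpha> \<beta> m
  let ?T' = "rauzy_step T"
  let ?t = "alpha_t (data T)" and ?b = "alpha_b (data T)"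
  assume \<alpha>: "1 < snd (data ?T') \<alpha>" and \<beta>: "1 < fst (data ?T') \<beta>"
    and eq: "(iem_map ?T' ^^ m) (left_b ?T' \<alpha>) = left_t ?T' \<beta>"
  note iem = assms(1) and iem' = is_iem_rauzy_step[OF assms] and c = is_iem_comb_data[OF assms(1)]
  note llt = last_left_t[OF iem] and llb = last_left_b[OF iem]
  have two: "2 \<le> CARD('a)"
    using c unfolding is_comb_data_def by blast
  have nc: "(iem_map T ^^ m) (left_b T \<alpha>) \<noteq> left_t T \<beta>"
    if "1 < snd (data T) \<alpha>" "1 < fst (data T) \<beta>" for \<alpha> \<beta> m
    using assms(2) that unfolding no_connection_iff[OF iem] by blast
  have "left_b ?T' \<alpha> \<in> {u_left T ..< u_right ?T'}"
    using left_b_bounds[OF iem', of \<alpha>] is_iem_rows(3)[OF iem', of \<alpha>]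
    by (simp add: rauzy_step_simps)
  then obtain k where k: "(iem_map T ^^ k) (left_b ?T' \<alpha>) = left_t ?T' \<beta>"
    using funpow_rauzy_step[OF assms, of "left_b ?T' \<alpha>" m] eq by auto
  show False
  proof (cases "type_of_step T")
    case TopType
    note l = left_rauzy_step_top[OF iem TopType]
    have \<beta>T: "1 < fst (data T) \<beta>"
      using \<beta> by (simp add: rauzy_step_simps TopType rauzy_data_def)
    show False
    proof (cases "\<alpha> = ?b")
      case False
      then have "1 < snd (data T) \<alpha>"
        using \<alpha> row_bounds(1)[OF is_iem_rows(2)[OF iem], of ?t]
        by (auto simp: rauzy_step_simps TopType rauzy_data_def move_after_def split: if_splits)
      then show False
        using nc[of \<alpha> \<beta> k] \<beta>T k False by (simp add: l)
    next
      case True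
      \<comment> \<open>The orbit of the old singularity \<open>left_b T ?b\<close> passes through the new one after one iteration.\<close>
      have "left_b T ?b \<in> I_t T ?t"
        using type_of_step_iff[OF iem] TopType is_iem_rows(3)[OF iem, of ?b]
        by (simp add: I_t_def llt llb)
      then have "iem_map T (left_b T ?b) = left_b ?T' \<alpha>"
        by (simp add: iem_map_translates[OF iem] l True llt llb)
      then have "(iem_map T ^^ Suc k) (left_b T ?b) = left_t T \<beta>"
        using k by (simp add: funpow_swap1 l)
      then show False
        using nc[of ?b \<beta> "Suc k"] \<beta>T two snd_alpha_b[OF c] by simp
    qed
  next
    case BottomType
    note l = left_rauzy_step_bottom[OF iem BottomType]
    have \<alpha>T: "1 < snd (data T) \<alpha>"
      using \<alpha> by (simp add: rauzy_step_simps BottomType rauzy_data_def)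
    show False
    proof (cases "\<beta> = ?t")
      case False
      then have "1 < fst (data T) \<beta>"
        using \<beta> row_bounds(1)[OF is_iem_rows(1)[OF iem], of ?b]
        by (auto simp: rauzy_step_simps BottomType rauzy_data_def move_after_def split: if_splits)
      then show False
        using nc[of \<alpha> \<beta> k] \<alpha>T k False by (simp add: l)
    next
      case True
      \<comment> \<open>The new singularity \<open>left_t ?T' ?t\<close> is mapped to the old one by one more iteration.\<close>
      have "left_t ?T' ?t \<in> I_t T ?b"
        using lose_less_win[OF assms] is_iem_rows(3)[OF iem, of ?t]
        by (simp add: I_t_def l BottomType win_def lose_def)
      then have "iem_map T (left_t ?T' ?t) = left_t T ?t"
        by (simp add: iem_map_translates[OF iem] l llt llb)
      then have "(iem_map T ^^ Suc k) (left_b T \<alpha>) = left_t T ?t"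
        using k True by (simp add: l(1))
      then show False
        using nc[of \<alpha> ?t "Suc k"] \<alpha>T two fst_alpha_t[OF c] by simp
    qed
  qed
qed

lemma rv_iter_rauzy_step:
  assumes "is_iem T" "no_connection T"
  shows "is_iem (rv_iter T n) \<and> no_connection (rv_iter T n) \<and>
    rv_iter T (Suc n) = rauzy_step (rv_iter T n)"
proof (induction n)
  case 0
  then show ?case
    using assms by (simp add: rv_iter_def elementary_step_eq)
next
  case (Suc n)
  then have "is_iem (rv_iter T (Suc n))" "no_connection (rv_iter T (Suc n))"
    using is_iem_rauzy_step no_connection_rauzy_step by metis+
  moreover have "rv_iter T (Suc (Suc n)) = elementary_step (rv_iter T (Suc n))"
    by (simp add: rv_iter_def)
  ultimately show ?case
    by (simp add: elementary_step_eq)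
qed

section \<open>Every letter wins infinitely often\<close>

text \<open>
  The combinatorial content of a rotation number: lengths are forgotten.
\<close>

definition rauzy_path :: "('a::finite) path \<Rightarrow> bool" where
  "rauzy_path \<gamma> \<longleftrightarrow> (\<forall>n. is_comb_data (source (\<gamma> n)) \<and>
     source (\<gamma> (Suc n)) = rauzy_data (arrow_type (\<gamma> n)) (source (\<gamma> n)))"

lemma winner_eq_win: "winner a = win (arrow_type a) (source a)"
  by (simp add: winner_def win_def)

lemma loser_eq_lose: "loser a = lose (arrow_type a) (source a)"
  by (simp add: loser_def lose_def)

lemma rauzy_path_source: "rauzy_path \<gamma> \<Longrightarrow> is_comb_data (source (\<gamma> n))"
  by (simp add: rauzy_path_def)

lemma rauzy_path_Suc:
  "rauzy_path \<gamma> \<Longrightarrow> source (\<gamma> (Suc n)) = rauzy_data (arrow_type (\<gamma> n)) (source (\<gamma> n))"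
  by (simp add: rauzy_path_def)

lemma rauzy_path_rotation_number:
  assumes "is_iem T" "no_connection T"
  shows "rauzy_path (rotation_number T)"
  using rv_iter_rauzy_step[OF assms] is_iem_comb_data[of "rv_iter T n" for n]
  by (simp add: rauzy_path_def rotation_number_def rauzy_step_simps)

lemma len_rv_iter_Suc:
  assumes "is_iem T" "no_connection T"
  defines "\<gamma> \<equiv> rotation_number T"
  shows "len (rv_iter T (Suc n)) = shorten (len (rv_iter T n)) (winner (\<gamma> n)) (loser (\<gamma> n))"
  using rv_iter_rauzy_step[OF assms(1,2), of n]
  by (simp add: \<gamma>_def rotation_number_def winner_eq_win loser_eq_lose rauzy_step_simps)

text \<open>
  Applied to the total length, this bounds the length of the losers; applied to positions, which are
  integers, it shows that a position that never decreases is eventually constant.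
\<close>

lemma eventually_small_decrements:
  fixes X :: "nat \<Rightarrow> real"
  assumes "\<forall>\<^sub>F n in sequentially. X (Suc n) \<le> X n" "\<And>n. 0 \<le> X n" "0 < e"
  shows "\<forall>\<^sub>F n in sequentially. X n - X (Suc n) < e"
proof -
  obtain m where m: "\<And>n. n \<ge> m \<Longrightarrow> X (Suc n) \<le> X n"
    using assms(1) unfolding eventually_sequentially by blast
  define Y where "Y n = X (n + m)" for n
  have "decseq Y"
    unfolding Y_def using m by (intro decseq_SucI) simp
  moreover have "\<forall>n. 0 \<le> Y n"
    using assms(2) by (simp add: Y_def)
  ultimately obtain L where L: "Y \<longlonglongrightarrow> L"
    by (rule decseq_convergent)
  have "(\<lambda>n. Y n - Y (Suc n)) \<longlonglongrightarrow> L - L"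
    by (intro tendsto_diff L LIMSEQ_Suc[OF L])
  then have "\<forall>\<^sub>F n in sequentially. Y n - Y (Suc n) < e"
    using assms(3) by (intro order_tendstoD(2)[of _ "L - L"]) simp_all
  then have "\<forall>\<^sub>F n in sequentially. X (n + m) - X (Suc (n + m)) < e"
    by (simp add: Y_def)
  then show ?thesis
    by (subst (asm) eventually_sequentially_seg[of "\<lambda>n. X n - X (Suc n) < e"])
qed

lemma rauzy_data_mono:
  assumes "\<alpha> \<noteq> lose s \<pi>"
  shows "fst \<pi> \<alpha> \<le> fst (rauzy_data s \<pi>) \<alpha>" "snd \<pi> \<alpha> \<le> snd (rauzy_data s \<pi>) \<alpha>"
  using assms by (cases s; simp add: rauzy_data_def move_after_def lose_def)+

text \<open>
  A letter behind the winner in the changed row is shifted by the loser's insertion, and no letter is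
  behind the winner in the other row.
\<close>

lemma rauzy_data_fixed_before_win:
  assumes "is_comb_data \<pi>" "\<alpha> \<noteq> lose s \<pi>" "\<alpha> \<noteq> win s \<pi>"
    and "fst (rauzy_data s \<pi>) \<alpha> = fst \<pi> \<alpha>" "snd (rauzy_data s \<pi>) \<alpha> = snd \<pi> \<alpha>"
  shows "fst \<pi> \<alpha> < fst \<pi> (win s \<pi>)" "snd \<pi> \<alpha> < snd \<pi> (win s \<pi>)"
proof -
  note rows = is_comb_data_rows[OF assms(1)]
  have ne: "fst \<pi> \<alpha> \<noteq> fst \<pi> (win s \<pi>)" "snd \<pi> \<alpha> \<noteq> snd \<pi> (win s \<pi>)"
    using assms(3) row_eq_iff[OF rows(1)] row_eq_iff[OF rows(2)] by blast+
  have "fst \<pi> \<alpha> \<le> fst \<pi> (win s \<pi>) \<and> snd \<pi> \<alpha> \<le> snd \<pi> (win s \<pi>)"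
  proof (cases s)
    case TopType
    then show ?thesis
      using assms(2,5) row_bounds(2)[OF rows(1), of \<alpha>] fst_alpha_t[OF assms(1)]
      by (auto simp: rauzy_data_def move_after_def win_def lose_def split: if_splits)
  next
    case BottomType
    then show ?thesis
      using assms(2,4) row_bounds(2)[OF rows(2), of \<alpha>] snd_alpha_b[OF assms(1)]
      by (auto simp: rauzy_data_def move_after_def win_def lose_def split: if_splits)
  qed
  then show "fst \<pi> \<alpha> < fst \<pi> (win s \<pi>)" "snd \<pi> \<alpha> < snd \<pi> (win s \<pi>)"
    using ne by linarith+
qed

lemma rauzy_data_lose:
  assumes "is_comb_data \<pi>"
  shows "fst \<pi> (win s \<pi>) < fst (rauzy_data s \<pi>) (lose s \<pi>) \<or>
      fst (rauzy_data s \<pi>) (lose s \<pi>) = fst \<pi> (lose s \<pi>)"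
    "snd \<pi> (win s \<pi>) < snd (rauzy_data s \<pi>) (lose s \<pi>) \<or>
      snd (rauzy_data s \<pi>) (lose s \<pi>) = snd \<pi> (lose s \<pi>)"
  using row_bounds(2)[OF is_comb_data_rows(1)[OF assms], of "alpha_b \<pi>"]
    row_bounds(2)[OF is_comb_data_rows(2)[OF assms], of "alpha_t \<pi>"]
  by (cases s; simp add: rauzy_data_def move_after_def win_def lose_def)+

lemma initial_block_row:
  fixes p :: "'a::finite \<Rightarrow> nat"
  assumes "is_row p" "\<And>\<alpha> \<beta>. \<alpha> \<in> N \<Longrightarrow> \<beta> \<notin> N \<Longrightarrow> p \<alpha> < p \<beta>"
  shows "p -` {1..card N} = N"
proof (intro equalityI subsetI)
  fix \<alpha> assume "\<alpha> \<in> N"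
  then have "{\<gamma>. p \<gamma> \<le> p \<alpha>} \<subseteq> N"
    using assms(2) by fastforce
  then have "p \<alpha> \<le> card N"
    using card_mono[of N "{\<gamma>. p \<gamma> \<le> p \<alpha>}"] row_card[OF assms(1), of \<alpha>] by simp
  then show "\<alpha> \<in> p -` {1..card N}"
    using row_bounds(1)[OF assms(1), of \<alpha>] by simp
next
  fix \<beta> assume \<beta>: "\<beta> \<in> p -` {1..card N}"
  show "\<beta> \<in> N"
  proof (rule ccontr)
    assume "\<beta> \<notin> N"
    then have "insert \<beta> N \<subseteq> {\<gamma>. p \<gamma> \<le> p \<beta>}"
      using assms(2) by (auto intro: less_imp_le)
    then have "card (insert \<beta> N) \<le> p \<beta>"
      using card_mono[of "{\<gamma>. p \<gamma> \<le> p \<beta>}" "insert \<beta> N"] row_card[OF assms(1), of \<beta>] by simp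
    then show False
      using \<beta> \<open>\<beta> \<notin> N\<close> by simp
  qed
qed

text \<open>
  Let \<open>N\<close> be the set of letters that win only finitely often. From some time on their lengths are
  constant. Each loss of such a letter would then shorten the total length by a fixed amount, so they
  also lose only finitely often. After that their positions never decrease, hence become constant, and
  so every letter of \<open>N\<close> stands before every winner in both rows. Each letter outside \<open>N\<close> wins again
  and remains behind \<open>N\<close> from then on, as a later loss only moves it behind another winner. So \<open>N\<close> is
  eventually an initial block of both rows, and irreducibility forces \<open>N\<close> to be empty.
\<close>

lemma winner_infinitely_often:
  fixes \<gamma> :: "('a::finite) path" and L :: "nat \<Rightarrow> real^'a"
  assumes path: "rauzy_path \<gamma>"
    and pos: "\<And>n \<alpha>. L n $ \<alpha> > 0"
    and L_Suc: "\<And>n. L (Suc n) = shorten (L n) (winner (\<gamma> n)) (loser (\<gamma> n))"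
  shows "\<exists>i\<ge>m. winner (\<gamma> i) = \<alpha>"
proof -
  define N where "N = {\<alpha>. \<forall>\<^sub>F i in sequentially. winner (\<gamma> i) \<noteq> \<alpha>}"
  define P where "P i \<beta> \<longleftrightarrow> (\<forall>\<alpha>\<in>N. fst (source (\<gamma> i)) \<alpha> < fst (source (\<gamma> i)) \<beta> \<and>
    snd (source (\<gamma> i)) \<alpha> < snd (source (\<gamma> i)) \<beta>)" for i \<beta>
  note comb = rauzy_path_source[OF path]
  note Suc_data = rauzy_path_Suc[OF path]
  have not_win: "\<forall>\<^sub>F i in sequentially. \<forall>\<alpha>\<in>N. winner (\<gamma> i) \<noteq> \<alpha>"
    by (intro eventually_ball_finite) (simp_all add: N_def)
  \<comment> \<open>The sum of the lengths drops by the length of the loser and stays positive.\<close>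
  have not_lose: "\<forall>\<^sub>F i in sequentially. \<forall>\<alpha>\<in>N. loser (\<gamma> i) \<noteq> \<alpha>"
  proof (intro eventually_ball_finite ballI)
    fix \<alpha> assume "\<alpha> \<in> N"
    then obtain m where m: "\<And>i. i \<ge> m \<Longrightarrow> winner (\<gamma> i) \<noteq> \<alpha>"
      unfolding N_def eventually_sequentially by blast
    have const: "L i $ \<alpha> = L m $ \<alpha>" if "i \<ge> m" for i
      using that
    proof (induction rule: dec_induct)
      case (step i)
      then show ?case
        using m[of i] by (auto simp: L_Suc shorten_def)
    qed simp
    define S where "S n = (\<Sum>\<beta>\<in>UNIV. L n $ \<beta>)" for n
    have S: "S n - S (Suc n) = L n $ loser (\<gamma> n)" for n
      by (simp add: S_def L_Suc sum_shorten)
    have "\<forall>\<^sub>F n in sequentially. S n - S (Suc n) < L m $ \<alpha>"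
    proof (rule eventually_small_decrements)
      have "S (Suc n) \<le> S n" for n
        using S[of n] pos[of n "loser (\<gamma> n)"] by linarith
      then show "\<forall>\<^sub>F n in sequentially. S (Suc n) \<le> S n"
        by simp
      show "0 \<le> S n" for n
        unfolding S_def by (intro sum_nonneg) (simp add: pos less_imp_le)
    qed (rule pos)
    then show "\<forall>\<^sub>F i in sequentially. loser (\<gamma> i) \<noteq> \<alpha>"
      using eventually_ge_at_top[of m]
    proof eventually_elim
      case (elim i)
      then show ?case
        using S[of i] const[of i] by auto
    qed
  qed simp
  \<comment> \<open>Letters that do not lose never move to the left in either row.\<close>
  have fixed: "\<forall>\<^sub>F i in sequentially. \<forall>\<alpha>\<in>N. p (source (\<gamma> (Suc i))) \<alpha> = p (source (\<gamma> i)) \<alpha>"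
    if p: "p = fst \<or> p = snd" for p :: "'a comb_data \<Rightarrow> 'a \<Rightarrow> nat"
  proof (intro eventually_ball_finite ballI)
    fix \<alpha> assume \<alpha>: "\<alpha> \<in> N"
    define X where "X i = real CARD('a) - real (p (source (\<gamma> i)) \<alpha>)" for i
    have incr: "\<forall>\<^sub>F i in sequentially. p (source (\<gamma> i)) \<alpha> \<le> p (source (\<gamma> (Suc i))) \<alpha>"
      using not_lose
    proof eventually_elim
      case (elim i)
      then show ?case
        using \<alpha> p rauzy_data_mono[of \<alpha> "arrow_type (\<gamma> i)" "source (\<gamma> i)"]
        by (auto simp: Suc_data loser_eq_lose)
    qed
    have "\<forall>\<^sub>F i in sequentially. X i - X (Suc i) < 1"
    proof (rule eventually_small_decrements)
      show "\<forall>\<^sub>F i in sequentially. X (Suc i) \<le> X i"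
        using incr by eventually_elim (simp add: X_def)
      show "0 \<le> X n" for n
        using p row_bounds(2)[OF is_comb_data_rows(1)[OF comb[of n]], of \<alpha>]
          row_bounds(2)[OF is_comb_data_rows(2)[OF comb[of n]], of \<alpha>]
        by (auto simp: X_def)
    qed simp
    then show "\<forall>\<^sub>F i in sequentially. p (source (\<gamma> (Suc i))) \<alpha> = p (source (\<gamma> i)) \<alpha>"
      using incr by eventually_elim (simp add: X_def)
  qed simp
  have "\<forall>\<^sub>F i in sequentially. \<forall>\<alpha>\<in>N. winner (\<gamma> i) \<noteq> \<alpha> \<and> loser (\<gamma> i) \<noteq> \<alpha> \<and>
      fst (source (\<gamma> (Suc i))) \<alpha> = fst (source (\<gamma> i)) \<alpha> \<and>
      snd (source (\<gamma> (Suc i))) \<alpha> = snd (source (\<gamma> i)) \<alpha>"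
    using not_win not_lose fixed[OF disjI1[OF refl]] fixed[OF disjI2[OF refl]]
    by eventually_elim blast
  then obtain m2 where m2: "\<And>i \<alpha>. i \<ge> m2 \<Longrightarrow> \<alpha> \<in> N \<Longrightarrow>
      winner (\<gamma> i) \<noteq> \<alpha> \<and> loser (\<gamma> i) \<noteq> \<alpha> \<and>
      fst (source (\<gamma> (Suc i))) \<alpha> = fst (source (\<gamma> i)) \<alpha> \<and>
      snd (source (\<gamma> (Suc i))) \<alpha> = snd (source (\<gamma> i)) \<alpha>"
    unfolding eventually_sequentially by blast
  have P_winner: "P i (winner (\<gamma> i))" if i: "i \<ge> m2" for i
    unfolding P_def
  proof
    fix \<alpha> assume "\<alpha> \<in> N"
    then show "fst (source (\<gamma> i)) \<alpha> < fst (source (\<gamma> i)) (winner (\<gamma> i)) \<and>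
        snd (source (\<gamma> i)) \<alpha> < snd (source (\<gamma> i)) (winner (\<gamma> i))"
      using rauzy_data_fixed_before_win[OF comb[of i], of \<alpha> "arrow_type (\<gamma> i)"] m2[OF i, of \<alpha>]
      by (auto simp: winner_eq_win loser_eq_lose Suc_data)
  qed
  have P_Suc: "P (Suc i) \<beta>" if i: "i \<ge> m2" and P: "P i \<beta>" for i \<beta>
    unfolding P_def
  proof
    fix \<alpha> assume \<alpha>: "\<alpha> \<in> N"
    have 1: "fst (source (\<gamma> i)) \<alpha> < fst (source (\<gamma> i)) \<beta>"
      "snd (source (\<gamma> i)) \<alpha> < snd (source (\<gamma> i)) \<beta>"
      using P \<alpha> by (simp_all add: P_def)
    have 2: "fst (source (\<gamma> i)) \<alpha> < fst (source (\<gamma> i)) (winner (\<gamma> i))"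
      "snd (source (\<gamma> i)) \<alpha> < snd (source (\<gamma> i)) (winner (\<gamma> i))"
      using P_winner[OF i] \<alpha> by (simp_all add: P_def)
    have 3: "fst (source (\<gamma> (Suc i))) \<alpha> = fst (source (\<gamma> i)) \<alpha>"
      "snd (source (\<gamma> (Suc i))) \<alpha> = snd (source (\<gamma> i)) \<alpha>"
      using m2[OF i \<alpha>] by simp_all
    show "fst (source (\<gamma> (Suc i))) \<alpha> < fst (source (\<gamma> (Suc i))) \<beta> \<and>
        snd (source (\<gamma> (Suc i))) \<alpha> < snd (source (\<gamma> (Suc i))) \<beta>"
    proof (cases "\<beta> = loser (\<gamma> i)")
      case True
      then show ?thesis
        unfolding 3 using 1 2 rauzy_data_lose[OF comb[of i], of "arrow_type (\<gamma> i)"]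
        unfolding Suc_data winner_eq_win loser_eq_lose by auto
    next
      case False
      then show ?thesis
        unfolding 3 using 1 rauzy_data_mono[of \<beta> "arrow_type (\<gamma> i)" "source (\<gamma> i)"]
        unfolding Suc_data loser_eq_lose by auto
    qed
  qed
  have "\<forall>\<^sub>F i in sequentially. \<forall>\<beta>\<in>- N. P i \<beta>"
  proof (intro eventually_ball_finite ballI)
    fix \<beta> assume "\<beta> \<in> - N"
    then obtain i where i: "i \<ge> m2" "winner (\<gamma> i) = \<beta>"
      unfolding N_def eventually_sequentially by blast
    have "P j \<beta>" if "j \<ge> i" for j
      using that
    proof (induction rule: dec_induct)
      case base
      then show ?case
        using P_winner[OF i(1)] i(2) by simp
    next
      case (step j)
      then show ?case
        using P_Suc[of j \<beta>] i(1) by simp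
    qed
    then show "\<forall>\<^sub>F i in sequentially. P i \<beta>"
      unfolding eventually_sequentially by blast
  qed simp
  then obtain j where j: "\<And>\<beta>. \<beta> \<notin> N \<Longrightarrow> P j \<beta>"
    unfolding eventually_sequentially by auto
  have blocks: "fst (source (\<gamma> j)) -` {1..card N} = N" "snd (source (\<gamma> j)) -` {1..card N} = N"
    by (rule initial_block_row; use j is_comb_data_rows[OF comb] in \<open>auto simp: P_def\<close>)+
  have "winner (\<gamma> m2) \<notin> N"
    using m2[of m2] by blast
  then have "card N < CARD('a)"
    by (intro psubset_card_mono) auto
  moreover have "irreducible_data (source (\<gamma> j))"
    using comb[of j] unfolding is_comb_data_def by blast
  ultimately have "\<not> 1 \<le> card N"
    using blocks unfolding irreducible_data_def by metis
  then have "N = {}"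
    by (simp add: not_le)
  then show ?thesis
    unfolding N_def eventually_sequentially by blast
qed

section \<open>Nonnegative matrices along a path\<close>

lemma B_mat_same [simp]: "B_mat \<gamma> m m = mat 1"
  by (cases m) simp_all

lemma B_mat_cocycle:
  assumes "m \<le> k" "k \<le> n"
  shows "B_mat \<gamma> m n = B_mat \<gamma> k n ** B_mat \<gamma> m k"
  using assms(2)
proof (induction rule: dec_induct)
  case (step n)
  then show ?case
    using assms(1) by (simp add: matrix_mul_assoc)
qed simp

lemma matrix_mult_mono:
  fixes A A' B B' :: "real^'a^'a::finite"
  assumes "0 \<le> A" "A \<le> A'" "0 \<le> B" "B \<le> B'"
  shows "A ** B \<le> A' ** B'"
proof -
  have "A $ \<alpha> $ \<delta> * B $ \<delta> $ \<beta> \<le> A' $ \<alpha> $ \<delta> * B' $ \<delta> $ \<beta>" for \<alpha> \<beta> \<delta>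
  proof (rule mult_mono')
    show "A $ \<alpha> $ \<delta> \<le> A' $ \<alpha> $ \<delta>" "B $ \<delta> $ \<beta> \<le> B' $ \<delta> $ \<beta>" "0 \<le> A $ \<alpha> $ \<delta>"
      "0 \<le> B $ \<delta> $ \<beta>"
      using assms by (simp_all add: less_eq_vec_def)
  qed
  then show ?thesis
    unfolding less_eq_vec_def matrix_matrix_mult_def vec_lambda_beta
    by (intro allI sum_mono)
qed

lemma mat_1_nonneg: "0 \<le> (mat 1 :: real^'a^'a::finite)"
  by (simp add: less_eq_vec_def mat_def)

lemma step_matrix_ge_1: "mat 1 \<le> step_matrix a"
  by (simp add: less_eq_vec_def step_matrix_def)

lemma B_mat_ge_1: "mat 1 \<le> B_mat \<gamma> m n"
proof (induction n)
  case (Suc n)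
  have "mat 1 ** mat 1 \<le> step_matrix (\<gamma> n) ** B_mat \<gamma> m n"
    by (rule matrix_mult_mono[OF mat_1_nonneg step_matrix_ge_1 mat_1_nonneg Suc])
  then show ?case
    by simp
qed simp

lemma B_mat_nonneg: "0 \<le> B_mat \<gamma> m n"
  using order_trans[OF mat_1_nonneg B_mat_ge_1] .

lemma B_mat_mono:
  assumes "m' \<le> m" "m \<le> n" "n \<le> n'"
  shows "B_mat \<gamma> m n \<le> B_mat \<gamma> m' n'"
proof -
  have "mat 1 ** (B_mat \<gamma> m n ** mat 1) \<le> B_mat \<gamma> n n' ** (B_mat \<gamma> m n ** B_mat \<gamma> m' m)"
    by (intro matrix_mult_mono mat_1_nonneg B_mat_ge_1 B_mat_nonneg order_refl)
      (simp add: B_mat_nonneg)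
  then show ?thesis
    using B_mat_cocycle[of m' m n \<gamma>] B_mat_cocycle[of m' n n' \<gamma>] assms by simp
qed

lemma step_matrix_mult_nth:
  "(step_matrix a ** M) $ \<alpha> $ \<beta> =
     M $ \<alpha> $ \<beta> + (if \<alpha> = loser a then M $ winner a $ \<beta> else 0)"
proof -
  have "(step_matrix a ** M) $ \<alpha> $ \<beta> = (\<Sum>\<delta>\<in>UNIV. (if \<alpha> = \<delta> then M $ \<delta> $ \<beta> else 0) +
      (if \<delta> = winner a then if \<alpha> = loser a then M $ \<delta> $ \<beta> else 0 else 0))"
    unfolding matrix_matrix_mult_def vec_lambda_beta
    by (intro sum.cong refl) (simp add: step_matrix_def mat_def algebra_simps)
  then show ?thesis
    by (simp add: sum.distrib)
qed

section \<open>Positive matrices\<close>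

text \<open>
  The winner keeps the last position in its row, so it takes part in the next step as well.
\<close>

lemma winner_contends_next:
  assumes "rauzy_path \<gamma>"
  shows "winner (\<gamma> n) = winner (\<gamma> (Suc n)) \<or> winner (\<gamma> n) = loser (\<gamma> (Suc n))"
  unfolding winner_def loser_def rauzy_path_Suc[OF assms]
  by (cases "arrow_type (\<gamma> n)"; cases "arrow_type (\<gamma> (Suc n))")
    (simp_all add: rauzy_data_def alpha_t_def alpha_b_def)

text \<open>
  If no letter of \<open>S\<close> ever beats a letter outside \<open>S\<close>, then once a letter outside \<open>S\<close> has won, all
  later winners lie outside \<open>S\<close>: the previous winner takes part in each step, and it either wins or is
  beaten by a letter outside \<open>S\<close>. The first complete segment provides such a win, and the second one
  contains a win of each letter of \<open>S\<close>.
\<close>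

lemma closed_letter_set_trivial:
  assumes path: "rauzy_path \<gamma>"
    and compl: "complete_segment \<gamma> m k" "complete_segment \<gamma> k n"
    and closed: "\<And>i. m \<le> i \<Longrightarrow> i < n \<Longrightarrow> winner (\<gamma> i) \<in> S \<Longrightarrow> loser (\<gamma> i) \<in> S"
  shows "S = {} \<or> S = UNIV"
proof (rule ccontr)
  assume "\<not> ?thesis"
  then obtain \<alpha> \<beta> where "\<alpha> \<notin> S" "\<beta> \<in> S"
    by blast
  obtain i where i: "m \<le> i" "i < k" "winner (\<gamma> i) = \<alpha>"
    using compl(1) unfolding complete_segment_def by blast
  obtain j where j: "k \<le> j" "j < n" "winner (\<gamma> j) = \<beta>"
    using compl(2) unfolding complete_segment_def by blast
  have "j' < n \<Longrightarrow> winner (\<gamma> j') \<notin> S" if "i \<le> j'" for j'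
    using that
  proof (induction rule: dec_induct)
    case base
    then show ?case
      using i(3) \<open>\<alpha> \<notin> S\<close> by simp
  next
    case (step j')
    then show ?case
      using closed[of "Suc j'"] i(1) winner_contends_next[OF path, of j'] by auto
  qed
  then show False
    using i(2) j \<open>\<beta> \<in> S\<close> by auto
qed

lemma complete_segment_less: "complete_segment \<gamma> m n \<Longrightarrow> m < n"
  by (fastforce simp: complete_segment_def)

text \<open>
  A step adds the winner's row to the loser's row. So the letters with a positive entry in a given
  column form a set that can only grow, and it gains the loser whenever it contains the winner. By
  the lemma \<open>closed_letter_set_trivial\<close> it gains a letter in every two consecutive complete segments until it is
  the whole alphabet.
\<close>

lemma complete_segments_positive:
  fixes \<gamma> :: "('a::finite) path" and t :: "nat \<Rightarrow> nat"
  assumes path: "rauzy_path \<gamma>"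
    and compl: "\<And>i. complete_segment \<gamma> (t i) (t (Suc i))"
  shows "0 < B_mat \<gamma> (t 0) (t (2 * CARD('a))) $ \<alpha> $ \<beta>"
proof -
  define S where "S n = {\<alpha>. 0 < B_mat \<gamma> (t 0) n $ \<alpha> $ \<beta>}" for n
  have t_mono: "mono t"
    by (intro incseq_SucI less_imp_le complete_segment_less[OF compl])
  have S_mono: "S m \<subseteq> S n" if "t 0 \<le> m" "m \<le> n" for m n
    using B_mat_mono[of "t 0" "t 0" m n \<gamma>] that
    by (auto simp: S_def less_eq_vec_def intro: less_le_trans)
  have S_loser: "loser (\<gamma> i) \<in> S (Suc i)" if "t 0 \<le> i" "winner (\<gamma> i) \<in> S i" for i
  proof -
    have "0 \<le> B_mat \<gamma> (t 0) i $ loser (\<gamma> i) $ \<beta>"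
      using B_mat_nonneg[of \<gamma> "t 0" i] by (simp add: less_eq_vec_def)
    then show ?thesis
      using that by (simp add: S_def step_matrix_mult_nth)
  qed
  \<comment> \<open>Each pair of complete segments adds at least one letter to the support of the column.\<close>
  have "min (Suc j) CARD('a) \<le> card (S (t (2 * j)))" for j
  proof (induction j)
    case 0
    have "\<beta> \<in> S (t 0)"
      by (simp add: S_def mat_def)
    then have "card {\<beta>} \<le> card (S (t 0))"
      by (intro card_mono) auto
    then show ?case
      by simp
  next
    case (Suc j)
    let ?m = "t (2 * j)" and ?n = "t (2 * Suc j)"
    have t0: "t 0 \<le> ?m"
      using monoD[OF t_mono] by simp
    have sub: "S ?m \<subseteq> S ?n"
      using S_mono[OF t0] monoD[OF t_mono] by simp
    show ?case
    proof (cases "S ?n = S ?m")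
      case True
      have const: "S i = S ?m" if "?m \<le> i" "i \<le> ?n" for i
        using S_mono[OF t0 that(1)] S_mono[OF _ that(2)] that t0 True by fastforce
      have "loser (\<gamma> i) \<in> S ?m" if "?m \<le> i" "i < ?n" "winner (\<gamma> i) \<in> S ?m" for i
        using that S_loser[of i] t0 const[of i] const[of "Suc i"] by simp
      then have "S ?m = {} \<or> S ?m = UNIV"
        using closed_letter_set_trivial[OF path compl[of "2 * j"] compl[of "Suc (2 * j)"]]
        by (simp add: numeral_2_eq_2)
      moreover have "S ?m \<noteq> {}"
        using Suc zero_less_card_finite[where 'a='a] by (auto simp: min_def split: if_splits)
      ultimately show ?thesis
        using True by simp
    next
      case False
      then have "card (S ?m) < card (S ?n)"
        using sub by (intro psubset_card_mono) auto
      then show ?thesis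
        using Suc by simp
    qed
  qed
  from this[of "CARD('a)"] have "card (S (t (2 * CARD('a)))) = card (UNIV :: 'a set)"
    using card_mono[of UNIV "S (t (2 * CARD('a)))"] by simp
  then have "S (t (2 * CARD('a))) = UNIV"
    by (intro card_subset_eq) auto
  then show ?thesis
    unfolding S_def by blast
qed

section \<open>The invariant subspaces and contraction of cones\<close>

lemma mult_transpose_step_matrix_nth:
  "(M ** transpose (step_matrix a)) $ \<alpha> $ \<beta> =
     M $ \<alpha> $ \<beta> + (if \<beta> = loser a then M $ \<alpha> $ winner a else 0)"
proof -
  have "M ** transpose (step_matrix a) = transpose (step_matrix a ** transpose M)"
    by (simp add: matrix_transpose_mul)
  then show ?thesis
    by (simp add: transpose_def step_matrix_mult_nth)
qed

lemma move_after_less_iff: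
  fixes p :: "'a::finite \<Rightarrow> nat"
  assumes "is_row p" "p x = CARD('a)" "w \<noteq> x"
  shows "\<alpha> \<noteq> x \<Longrightarrow> \<beta> \<noteq> x \<Longrightarrow> move_after p w x \<alpha> < move_after p w x \<beta> \<longleftrightarrow> p \<alpha> < p \<beta>"
    and "\<beta> \<noteq> x \<Longrightarrow> move_after p w x x < move_after p w x \<beta> \<longleftrightarrow> p w < p \<beta>"
    and "\<beta> \<noteq> x \<Longrightarrow> move_after p w x \<beta> < move_after p w x x \<longleftrightarrow> p \<beta> \<le> p w"
proof -
  have "p w < p x"
    using row_bounds(2)[OF assms(1), of w] row_eq_iff[OF assms(1), of w x] assms(2,3) by linarith
  then show "\<alpha> \<noteq> x \<Longrightarrow> \<beta> \<noteq> x \<Longrightarrow> move_after p w x \<alpha> < move_after p w x \<beta> \<longleftrightarrow> p \<alpha> < p \<beta>"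
    "\<beta> \<noteq> x \<Longrightarrow> move_after p w x x < move_after p w x \<beta> \<longleftrightarrow> p w < p \<beta>"
    "\<beta> \<noteq> x \<Longrightarrow> move_after p w x \<beta> < move_after p w x x \<longleftrightarrow> p \<beta> \<le> p w"
    by (auto simp: move_after_def)
qed

text \<open>
  The matrix \<open>\<Omega>\<close> is the intersection form, and a step acts on it as a change of basis. In entries: the
  loser's new crossings are the sum of its old ones and those of the winner.
\<close>

lemma Omega_rauzy_data:
  fixes a :: "('a::finite) arrow"
  assumes c: "is_comb_data (source a)"
  shows "step_matrix a ** Omega (source a) ** transpose (step_matrix a) =
    Omega (rauzy_data (arrow_type a) (source a))"
proof -
  let ?\<pi> = "source a" and ?t = "alpha_t (source a)" and ?b = "alpha_b (source a)"
  note rows = is_comb_data_rows[OF c]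
  note ne = alpha_t_neq_alpha_b[OF c]
  have t_last: "fst ?\<pi> \<alpha> < fst ?\<pi> ?t" if "\<alpha> \<noteq> ?t" for \<alpha>
    using row_bounds(2)[OF rows(1), of \<alpha>] alpha_t_iff[OF c, of \<alpha>] fst_alpha_t[OF c] that by linarith
  have b_last: "snd ?\<pi> \<alpha> < snd ?\<pi> ?b" if "\<alpha> \<noteq> ?b" for \<alpha>
    using row_bounds(2)[OF rows(2), of \<alpha>] alpha_b_iff[OF c, of \<alpha>] snd_alpha_b[OF c] that by linarith
  have inj: "\<And>\<alpha> \<beta>. fst ?\<pi> \<alpha> = fst ?\<pi> \<beta> \<longleftrightarrow> \<alpha> = \<beta>" "\<And>\<alpha> \<beta>. snd ?\<pi> \<alpha> = snd ?\<pi> \<beta> \<longleftrightarrow> \<alpha> = \<beta>"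
    using row_eq_iff[OF rows(1)] row_eq_iff[OF rows(2)] by blast+
  have "(step_matrix a ** Omega ?\<pi> ** transpose (step_matrix a)) $ \<alpha> $ \<beta> =
      Omega (rauzy_data (arrow_type a) ?\<pi>) $ \<alpha> $ \<beta>" for \<alpha> \<beta>
  proof (cases "arrow_type a")
    case TopType
    note mv = move_after_less_iff[OF rows(2) snd_alpha_b[OF c] ne]
    have wl: "winner a = ?t" "loser a = ?b"
      by (simp_all add: winner_def loser_def TopType)
    show ?thesis
      unfolding mult_transpose_step_matrix_nth step_matrix_mult_nth wl
      using t_last[of \<alpha>] t_last[of \<beta>] b_last[of \<alpha>] b_last[of \<beta>] ne inj(2)[of \<alpha> ?t] inj(2)[of \<beta> ?t]
        inj(1)[of \<alpha> ?b] inj(1)[of \<beta> ?b]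
      by (cases "\<alpha> = ?b"; cases "\<beta> = ?b"; cases "\<alpha> = ?t"; cases "\<beta> = ?t")
        (auto simp: Omega_def rauzy_data_def TopType mv)
  next
    case BottomType
    note mv = move_after_less_iff[OF rows(1) fst_alpha_t[OF c] ne[symmetric]]
    have wl: "winner a = ?b" "loser a = ?t"
      by (simp_all add: winner_def loser_def BottomType)
    show ?thesis
      unfolding mult_transpose_step_matrix_nth step_matrix_mult_nth wl
      using t_last[of \<alpha>] t_last[of \<beta>] b_last[of \<alpha>] b_last[of \<beta>] ne inj(1)[of \<alpha> ?b] inj(1)[of \<beta> ?b]
        inj(2)[of \<alpha> ?t] inj(2)[of \<beta> ?t]
      by (cases "\<alpha> = ?b"; cases "\<beta> = ?b"; cases "\<alpha> = ?t"; cases "\<beta> = ?t")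
        (auto simp: Omega_def rauzy_data_def BottomType mv)
  qed
  then show ?thesis
    by (simp add: vec_eq_iff)
qed

text \<open>
  The transposed matrix turns new lengths into old ones, and shortening inverts it. So it is onto, and
  the congruence of \<open>Omega_rauzy_data\<close> maps the image of one \<open>\<Omega>\<close> into that of the other.
\<close>

lemma transpose_step_matrix_shorten:
  assumes "winner a \<noteq> loser a"
  shows "transpose (step_matrix a) *v shorten v (winner a) (loser a) = v"
proof -
  let ?y = "shorten v (winner a) (loser a)"
  have "(transpose (step_matrix a) *v ?y) $ \<beta> =
      (\<Sum>\<alpha>\<in>UNIV. (if \<alpha> = \<beta> then ?y $ \<alpha> else 0) +
        (if \<alpha> = loser a then if \<beta> = winner a then ?y $ \<alpha> else 0 else 0))" for \<beta>
    unfolding matrix_vector_mult_def vec_lambda_beta transpose_def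
    by (intro sum.cong refl) (simp add: step_matrix_def mat_def algebra_simps)
  then show ?thesis
    using assms by (simp add: vec_eq_iff sum.distrib) (auto simp: shorten_def)
qed

lemma step_matrix_H_space:
  assumes "is_comb_data (source a)" "h \<in> H_space (source a)"
  shows "step_matrix a *v h \<in> H_space (rauzy_data (arrow_type a) (source a))"
proof -
  obtain v where v: "h = Omega (source a) *v v"
    using assms(2) by (auto simp: H_space_def)
  let ?y = "shorten v (winner a) (loser a)"
  have "winner a \<noteq> loser a"
    using win_neq_lose[OF assms(1)] by (simp add: winner_eq_win loser_eq_lose)
  then have "h = Omega (source a) *v (transpose (step_matrix a) *v ?y)"
    using v transpose_step_matrix_shorten[of a v] by metis
  then have "step_matrix a *v h =
      (step_matrix a ** Omega (source a) ** transpose (step_matrix a)) *v ?y"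
    by (simp only: matrix_vector_mul_assoc matrix_mul_assoc)
  then show ?thesis
    unfolding Omega_rauzy_data[OF assms(1)] by (simp add: H_space_def)
qed

lemma B_mat_H_space:
  assumes "rauzy_path \<gamma>" "h \<in> H_space (source (\<gamma> m))" "m \<le> n"
  shows "B_mat \<gamma> m n *v h \<in> H_space (source (\<gamma> n))"
  using assms(3)
proof (induction rule: dec_induct)
  case base
  then show ?case
    using assms(2) by simp
next
  case (step n)
  then show ?case
    using step_matrix_H_space[OF rauzy_path_source[OF assms(1)] step.IH]
    by (simp add: rauzy_path_Suc[OF assms(1)] matrix_vector_mul_assoc)
qed

lemma closed_H_space: "closed (H_space \<pi>)"
  unfolding H_space_def
  by (intro closed_subspace linear_subspace_image subspace_UNIV matrix_vector_mul_linear)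

lemma closed_wide_cone:
  fixes e :: real
  shows "closed {y :: real^'a::finite. \<forall>\<alpha> \<beta>. 0 \<le> y $ \<alpha> \<and> e * y $ \<beta> \<le> y $ \<alpha>}"
  by (intro closed_Collect_all closed_Collect_conj closed_Collect_le continuous_intros)

text \<open>
  The coordinates of the image of a nonnegative vector are comparable up to a factor depending only on the matrix, since
  the entries of each column are. This condition is closed, and it makes every nonzero vector
  in the nonnegative orthant positive. Within \<open>H\<close>, which the path preserves, it therefore also
  controls the closure of the image.
\<close>

lemma contracting_segment_positive:
  fixes \<gamma> :: "('a::finite) path"
  assumes path: "rauzy_path \<gamma>" and "m \<le> n" and pos: "\<And>\<alpha> \<beta>. 0 < B_mat \<gamma> m n $ \<alpha> $ \<beta>"
  shows "contracting_segment \<gamma> m n"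
proof -
  let ?B = "B_mat \<gamma> m n"
  define E where "E = range (\<lambda>(\<alpha>, \<beta>). ?B $ \<alpha> $ \<beta>)"
  \<comment> \<open>The factor by which coordinates of an image vector can differ at most.\<close>
  define e where "e = Min E / Max E"
  define K where "K = H_space (source (\<gamma> n)) \<inter> {y. \<forall>\<alpha> \<beta>. 0 \<le> y $ \<alpha> \<and> e * y $ \<beta> \<le> y $ \<alpha>}"
  have E: "finite E" "E \<noteq> {}" "\<And>x. x \<in> E \<Longrightarrow> 0 < x" "\<And>\<alpha> \<beta>. ?B $ \<alpha> $ \<beta> \<in> E"
    using pos by (auto simp: E_def)
  have e: "0 < e"
    unfolding e_def using E Max_in[of E] Min_in[of E] by (intro divide_pos_pos) blast+
  have ratio: "e * ?B $ \<beta> $ \<delta> \<le> ?B $ \<alpha> $ \<delta>" for \<alpha> \<beta> \<delta>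
  proof -
    have "e * ?B $ \<beta> $ \<delta> \<le> e * Max E"
      using e E by (intro mult_left_mono Max_ge) (simp_all add: less_imp_le)
    also have "\<dots> = Min E"
      using E(3)[OF Max_in[OF E(1,2)]] by (simp add: e_def)
    also have "\<dots> \<le> ?B $ \<alpha> $ \<delta>"
      using E by (intro Min_le)
    finally show ?thesis .
  qed
  have "(\<lambda>v. ?B *v v) ` pos_cone_H (source (\<gamma> m)) \<subseteq> K"
  proof (rule image_subsetI)
    fix v assume v: "v \<in> pos_cone_H (source (\<gamma> m))"
    then have vpos: "0 \<le> v $ \<delta>" for \<delta>
      by (auto simp: pos_cone_H_def positive_cone_def less_imp_le)
    have "0 \<le> (?B *v v) $ \<alpha>" for \<alpha>
      unfolding matrix_vector_mult_def vec_lambda_beta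
      by (intro sum_nonneg mult_nonneg_nonneg vpos less_imp_le[OF pos])
    moreover have "e * (?B *v v) $ \<beta> \<le> (?B *v v) $ \<alpha>" for \<alpha> \<beta>
      unfolding matrix_vector_mult_def vec_lambda_beta sum_distrib_left mult.assoc[symmetric]
      by (intro sum_mono mult_right_mono ratio vpos)
    ultimately show "?B *v v \<in> K"
      using B_mat_H_space[OF path _ assms(2)] v by (simp add: K_def pos_cone_H_def)
  qed
  moreover have "closed K"
    unfolding K_def by (intro closed_Int closed_H_space closed_wide_cone)
  ultimately have "closure ((\<lambda>v. ?B *v v) ` pos_cone_H (source (\<gamma> m))) \<subseteq> K"
    by (rule closure_minimal)
  moreover have "y \<in> pos_cone_H (source (\<gamma> n)) \<union> {0}" if y: "y \<in> K" for y
  proof (cases "y = 0")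
    case False
    then obtain \<beta> where "y $ \<beta> \<noteq> 0"
      by (auto simp: vec_eq_iff)
    moreover have "0 \<le> y $ \<beta>"
      using y by (simp add: K_def)
    ultimately have "0 < e * y $ \<beta>"
      using e by simp
    moreover have "e * y $ \<beta> \<le> y $ \<alpha>" for \<alpha>
      using y by (simp add: K_def)
    ultimately have "0 < y $ \<alpha>" for \<alpha>
      using less_le_trans by blast
    then show ?thesis
      using y by (simp add: K_def pos_cone_H_def positive_cone_def)
  qed simp
  ultimately show ?thesis
    unfolding contracting_segment_def by blast
qed

section \<open>Growth along complete segments\<close>

lemma mat_norm_ge_row: "(\<Sum>\<beta>\<in>UNIV. \<bar>B $ \<alpha> $ \<beta>\<bar>) \<le> mat_norm B"
  unfolding mat_norm_def by (rule Max_ge) auto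

lemma mat_norm_leI: "(\<And>\<alpha>. (\<Sum>\<beta>\<in>UNIV. \<bar>B $ \<alpha> $ \<beta>\<bar>) \<le> c) \<Longrightarrow> mat_norm B \<le> c"
  unfolding mat_norm_def by (intro Max.boundedI) auto

lemma mat_norm_mult: "mat_norm (A ** B) \<le> mat_norm A * mat_norm B"
proof (rule mat_norm_leI)
  fix \<alpha>
  have B: "0 \<le> mat_norm B"
    by (rule order_trans[OF sum_nonneg mat_norm_ge_row]) simp
  have "(\<Sum>\<beta>\<in>UNIV. \<bar>(A ** B) $ \<alpha> $ \<beta>\<bar>) \<le> (\<Sum>\<beta>\<in>UNIV. \<Sum>\<delta>\<in>UNIV. \<bar>A $ \<alpha> $ \<delta>\<bar> * \<bar>B $ \<delta> $ \<beta>\<bar>)"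
    unfolding matrix_matrix_mult_def vec_lambda_beta
    by (intro sum_mono order_trans[OF sum_abs]) (simp add: abs_mult)
  also have "\<dots> = (\<Sum>\<delta>\<in>UNIV. \<bar>A $ \<alpha> $ \<delta>\<bar> * (\<Sum>\<beta>\<in>UNIV. \<bar>B $ \<delta> $ \<beta>\<bar>))"
    by (subst sum.swap) (simp add: sum_distrib_left)
  also have "\<dots> \<le> (\<Sum>\<delta>\<in>UNIV. \<bar>A $ \<alpha> $ \<delta>\<bar> * mat_norm B)"
    by (intro sum_mono mult_left_mono mat_norm_ge_row) simp
  also have "\<dots> \<le> mat_norm A * mat_norm B"
    unfolding sum_distrib_right[symmetric] by (intro mult_right_mono mat_norm_ge_row B)
  finally show "(\<Sum>\<beta>\<in>UNIV. \<bar>(A ** B) $ \<alpha> $ \<beta>\<bar>) \<le> mat_norm A * mat_norm B" .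
qed

lemma mat_norm_mono:
  assumes "0 \<le> A" "A \<le> B"
  shows "mat_norm A \<le> mat_norm B"
proof (rule mat_norm_leI)
  fix \<alpha>
  have "0 \<le> A $ \<alpha> $ \<beta> \<and> A $ \<alpha> $ \<beta> \<le> B $ \<alpha> $ \<beta>" for \<beta>
    using assms by (simp add: less_eq_vec_def)
  then have "\<bar>A $ \<alpha> $ \<beta>\<bar> \<le> \<bar>B $ \<alpha> $ \<beta>\<bar>" for \<beta>
    by (smt (verit))
  then have "(\<Sum>\<beta>\<in>UNIV. \<bar>A $ \<alpha> $ \<beta>\<bar>) \<le> (\<Sum>\<beta>\<in>UNIV. \<bar>B $ \<alpha> $ \<beta>\<bar>)"
    by (intro sum_mono)
  also have "\<dots> \<le> mat_norm B"
    by (rule mat_norm_ge_row)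
  finally show "(\<Sum>\<beta>\<in>UNIV. \<bar>A $ \<alpha> $ \<beta>\<bar>) \<le> mat_norm B" .
qed

lemma mat_norm_mat_1: "mat_norm (mat 1 :: real^'a^'a::finite) = 1"
proof -
  have "\<bar>(mat 1 :: real^'a^'a) $ \<alpha> $ \<beta>\<bar> = (if \<beta> = \<alpha> then 1 else 0)" for \<alpha> \<beta>
    by (simp add: mat_def)
  then show ?thesis
    by (simp add: mat_norm_def)
qed

lemma mat_norm_B_mat_ge_1: "1 \<le> mat_norm (B_mat \<gamma> m n)"
  using mat_norm_mono[OF mat_1_nonneg B_mat_ge_1] by (simp add: mat_norm_mat_1)

lemma mat_norm_B_mat_mono:
  assumes "m' \<le> m" "m \<le> n" "n \<le> n'"
  shows "mat_norm (B_mat \<gamma> m n) \<le> mat_norm (B_mat \<gamma> m' n')"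
  by (intro mat_norm_mono B_mat_nonneg B_mat_mono assms)

lemma mat_norm_B_mat_cocycle:
  assumes "m \<le> k" "k \<le> n"
  shows "mat_norm (B_mat \<gamma> m n) \<le> mat_norm (B_mat \<gamma> k n) * mat_norm (B_mat \<gamma> m k)"
  unfolding B_mat_cocycle[OF assms] by (rule mat_norm_mult)

lemma complete_segment_exists:
  fixes \<gamma> :: "('a::finite) path"
  assumes "\<And>m \<alpha>. \<exists>i\<ge>m. winner (\<gamma> i) = \<alpha>"
  shows "\<exists>n>m. complete_segment \<gamma> m n"
proof -
  obtain f where f: "\<And>\<alpha>. m \<le> f \<alpha>" "\<And>\<alpha>. winner (\<gamma> (f \<alpha>)) = \<alpha>"
    using assms[of m] by metis
  have "f \<alpha> < Suc (Max (range f))" for \<alpha>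
    by (simp add: less_Suc_eq_le)
  then have "complete_segment \<gamma> m (Suc (Max (range f)))"
    unfolding complete_segment_def using f by blast
  then show ?thesis
    using complete_segment_less by blast
qed

lemma complete_times_Suc:
  assumes "\<And>m \<alpha>. \<exists>i\<ge>m. winner (\<gamma> i) = \<alpha>"
  shows "complete_segment \<gamma> (complete_times \<gamma> k) (complete_times \<gamma> (Suc k))"
  using LeastI_ex[OF complete_segment_exists[OF assms, of "complete_times \<gamma> k"]] by simp

text \<open>
  Condition (a) may be applied to any fixed number of complete segments: the norms over the earlier
  ones are powers of the norm at the start, and every exponent can be made small in advance.
\<close>

lemma growth_over_complete_segments:
  fixes \<gamma> :: "('a::finite) path"
  assumes wins: "\<And>m \<alpha>. \<exists>i\<ge>m. winner (\<gamma> i) = \<alpha>" and a: "condition_a \<gamma>"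
  defines "N \<equiv> complete_times \<gamma>"
  shows "0 < \<tau> \<Longrightarrow> \<exists>C>0. \<forall>l. mat_norm (B_mat \<gamma> (N l) (N (l + s)))
    \<le> C * mat_norm (B_mat \<gamma> 0 (N l)) powr \<tau>"
proof (induction s arbitrary: \<tau>)
  case 0
  have "1 \<le> mat_norm (B_mat \<gamma> 0 (N l)) powr \<tau>" for l
    using 0 by (intro ge_one_powr_ge_zero mat_norm_B_mat_ge_1) simp
  then show ?case
    by (intro exI[of _ 1]) (simp add: mat_norm_mat_1)
next
  case (Suc s)
  have "complete_segment \<gamma> (N k) (N (Suc k))" for k
    unfolding N_def by (rule complete_times_Suc[OF wins])
  then have "incseq N"
    by (intro incseq_SucI less_imp_le complete_segment_less)
  then have N_mono: "\<And>i j. i \<le> j \<Longrightarrow> N i \<le> N j"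
    by (rule monoD)
  \<comment> \<open>The norm at the start of the last segment is at most of order \<open>a\<^sup>2\<close>, so exponent \<open>\<tau> / 4\<close> there costs \<open>\<tau> / 2\<close>.\<close>
  have \<tau>: "0 < \<tau> / 2" "0 < \<tau> / 4"
    using Suc.prems by simp_all
  obtain C1 where C1: "0 < C1" "\<And>l. mat_norm (B_mat \<gamma> (N l) (N (l + s)))
      \<le> C1 * mat_norm (B_mat \<gamma> 0 (N l)) powr 1"
    using Suc.IH[of 1] by auto
  obtain C2 where C2: "0 < C2" "\<And>l. mat_norm (B_mat \<gamma> (N l) (N (l + s)))
      \<le> C2 * mat_norm (B_mat \<gamma> 0 (N l)) powr (\<tau> / 2)"
    using Suc.IH[OF \<tau>(1)] by auto
  obtain C3 where C3: "0 < C3" "\<And>k. 0 < k \<Longrightarrow> mat_norm (B_mat \<gamma> (N (k - 1)) (N k))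
      \<le> C3 * mat_norm (B_mat \<gamma> (N 0) (N (k - 1))) powr (\<tau> / 4)"
    using a \<tau>(2) unfolding condition_a_def N_def by blast
  have "mat_norm (B_mat \<gamma> (N l) (N (l + Suc s)))
      \<le> C3 * C1 powr (\<tau> / 4) * C2 * mat_norm (B_mat \<gamma> 0 (N l)) powr \<tau>" for l
  proof -
    define a where "a = mat_norm (B_mat \<gamma> 0 (N l))"
    define w where "w = mat_norm (B_mat \<gamma> 0 (N (l + s)))"
    define u where "u = mat_norm (B_mat \<gamma> (N l) (N (l + s)))"
    define v where "v = mat_norm (B_mat \<gamma> (N (l + s)) (N (Suc (l + s))))"
    have ge_1: "1 \<le> a" "1 \<le> w" "1 \<le> u"
      by (simp_all add: a_def w_def u_def mat_norm_B_mat_ge_1)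
    have "w \<le> u * a"
      unfolding w_def u_def a_def by (rule mat_norm_B_mat_cocycle) (simp_all add: N_mono)
    also have "\<dots> \<le> C1 * a * a"
      using C1(2)[of l] ge_1 by (intro mult_right_mono) (simp_all add: u_def a_def)
    also have "\<dots> = C1 * a powr 2"
      using ge_1 by (simp add: power2_eq_square)
    finally have w: "w \<le> C1 * a powr 2" .
    have "v \<le> C3 * w powr (\<tau> / 4)"
      using C3(2)[of "Suc (l + s)"] by (simp add: v_def w_def N_def)
    also have "\<dots> \<le> C3 * (C1 * a powr 2) powr (\<tau> / 4)"
      using w ge_1 C3(1) \<tau>(2) by (intro mult_left_mono powr_mono2) simp_all
    also have "\<dots> = C3 * C1 powr (\<tau> / 4) * a powr (\<tau> / 2)"
      using C1(1) by (simp add: powr_mult powr_powr)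
    finally have v: "v \<le> C3 * C1 powr (\<tau> / 4) * a powr (\<tau> / 2)" .
    have "mat_norm (B_mat \<gamma> (N l) (N (l + Suc s))) \<le> v * u"
      using mat_norm_B_mat_cocycle[of "N l" "N (l + s)" "N (l + Suc s)" \<gamma>]
      by (simp add: N_mono v_def u_def)
    also have "\<dots> \<le> (C3 * C1 powr (\<tau> / 4) * a powr (\<tau> / 2)) * (C2 * a powr (\<tau> / 2))"
      using v C2(2)[of l] ge_1 C3(1) by (intro mult_mono) (simp_all add: u_def a_def)
    also have "\<dots> = C3 * C1 powr (\<tau> / 4) * C2 * (a powr (\<tau> / 2) * a powr (\<tau> / 2))"
      by (simp only: mult_ac)
    also have "a powr (\<tau> / 2) * a powr (\<tau> / 2) = a powr \<tau>"
      by (simp add: powr_add[symmetric])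
    finally show ?thesis
      by (simp add: a_def)
  qed
  moreover have "0 < C3 * C1 powr (\<tau> / 4) * C2"
    using C1(1) C2(1) C3(1) by simp
  ultimately show ?case
    by blast
qed

text \<open>
  A contracting time \<open>m\<close> lies between two consecutive complete times. The segment from \<open>m\<close> through the
  \<open>2 d\<close> complete segments after the next complete time is positive, hence contracting, so it reaches at
  least to the next contracting time. An upper bound on the contracting times suffices, since the
  norms of the matrices along the path grow with the segment.
\<close>

lemma condition_a_imp_condition_a':
  fixes \<gamma> :: "('a::finite) path"
  assumes path: "rauzy_path \<gamma>" and wins: "\<And>m \<alpha>. \<exists>i\<ge>m. winner (\<gamma> i) = \<alpha>"
    and a: "condition_a \<gamma>"
  shows "condition_a' \<gamma>"
  unfolding condition_a'_def
proof (intro allI impI)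
  fix \<tau> :: real assume "0 < \<tau>"
  define N where "N = complete_times \<gamma>"
  \<comment> \<open>One segment containing the contracting time, then those that make the matrix positive.\<close>
  define s where "s = Suc (2 * CARD('a))"
  have compl: "complete_segment \<gamma> (N k) (N (Suc k))" for k
    unfolding N_def by (rule complete_times_Suc[OF wins])
  have N_Suc: "N k < N (Suc k)" for k
    by (rule complete_segment_less[OF compl])
  then have N: "strict_mono N"
    by (rule strict_monoI_Suc)
  obtain C where C: "0 < C" "\<And>l. mat_norm (B_mat \<gamma> (N l) (N (l + s)))
      \<le> C * mat_norm (B_mat \<gamma> 0 (N l)) powr \<tau>"
    using growth_over_complete_segments[OF wins a \<open>0 < \<tau>\<close>, of s] by (auto simp: N_def)
  have "mat_norm (B_mat \<gamma> (contracting_times \<gamma> k) (contracting_times \<gamma> (Suc k)))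
      \<le> C * mat_norm (B_mat \<gamma> 0 (contracting_times \<gamma> k)) powr \<tau>" for k
  proof -
    define m where "m = contracting_times \<gamma> k"
    have "m < N (Suc m)"
      using strict_mono_imp_increasing[OF N, of m] N_Suc[of m] by linarith
    moreover have "\<not> m < N 0"
      by (simp add: N_def)
    ultimately obtain l where l: "N l \<le> m" "m < N (Suc l)"
      using ex_least_nat_less[of "\<lambda>i. m < N i" "Suc m"] by (auto simp: not_less)
    define n where "n = N (l + s)"
    have mn: "m < n"
      using l(2) strict_mono_less_eq[OF N, of "Suc l" "l + s"] by (simp add: n_def s_def)
    have "0 < B_mat \<gamma> m n $ \<alpha> $ \<beta>" for \<alpha> \<beta>
    proof -
      have "0 < B_mat \<gamma> (N (Suc l)) n $ \<alpha> $ \<beta>"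
        using complete_segments_positive[OF path, of "\<lambda>i. N (Suc l + i)" \<alpha> \<beta>] compl
        by (simp add: n_def s_def)
      also have "\<dots> \<le> B_mat \<gamma> m n $ \<alpha> $ \<beta>"
        using B_mat_mono[of m "N (Suc l)" n n \<gamma>] l(2) strict_mono_less_eq[OF N, of "Suc l" "l + s"]
        by (simp add: less_eq_vec_def n_def s_def)
      finally show ?thesis .
    qed
    then have n: "m < n \<and> contracting_segment \<gamma> m n"
      using contracting_segment_positive[OF path less_imp_le[OF mn]] mn by blast
    let ?n = "contracting_times \<gamma> (Suc k)"
    have "?n = (LEAST n. m < n \<and> contracting_segment \<gamma> m n)"
      by (simp add: m_def)
    then have "?n \<le> n" "m < ?n"
      using Least_le[of "\<lambda>n. m < n \<and> contracting_segment \<gamma> m n", OF n]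
        LeastI[of "\<lambda>n. m < n \<and> contracting_segment \<gamma> m n", OF n] by simp_all
    then have "mat_norm (B_mat \<gamma> m ?n) \<le> mat_norm (B_mat \<gamma> (N l) n)"
      using l(1) by (intro mat_norm_B_mat_mono) simp_all
    also have "\<dots> \<le> C * mat_norm (B_mat \<gamma> 0 (N l)) powr \<tau>"
      unfolding n_def by (rule C(2))
    also have "\<dots> \<le> C * mat_norm (B_mat \<gamma> 0 m) powr \<tau>"
      using C(1) \<open>0 < \<tau>\<close> l(1) mat_norm_B_mat_ge_1[of \<gamma> 0 "N l"]
      by (intro mult_left_mono powr_mono2 mat_norm_B_mat_mono) simp_all
    finally show ?thesis
      by (simp add: m_def)
  qed
  then have "\<forall>k>0. mat_norm (B_mat \<gamma> (contracting_times \<gamma> (k - 1)) (contracting_times \<gamma> k))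
      \<le> C * mat_norm (B_mat \<gamma> (contracting_times \<gamma> 0) (contracting_times \<gamma> (k - 1))) powr \<tau>"
    by (metis Suc_diff_1 contracting_times.simps(1))
  then show "\<exists>C>0. \<forall>k>0. mat_norm (B_mat \<gamma> (contracting_times \<gamma> (k - 1)) (contracting_times \<gamma> k))
      \<le> C * mat_norm (B_mat \<gamma> (contracting_times \<gamma> 0) (contracting_times \<gamma> (k - 1))) powr \<tau>"
    using C(1) by blast
qed

section \<open>Roth type implies absolute Roth type\<close>

theorem lemma3p6:
  shows "(\<forall>T :: ('a::finite) iem.
            is_iem T \<and> no_connection T \<and> condition_a (rotation_number T)
              \<longrightarrow> condition_a' (rotation_number T)) \<and>
         (\<forall>T :: 'a iem. roth_type T \<longrightarrow> absolute_roth_type T) \<and>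
         (\<forall>T :: 'a iem. restricted_roth_type T \<longrightarrow> restricted_absolute_roth_type T)"
proof -
  have "condition_a' (rotation_number T)"
    if T: "is_iem T" "no_connection T" and a: "condition_a (rotation_number T)" for T :: "'a iem"
  proof (rule condition_a_imp_condition_a'[OF rauzy_path_rotation_number[OF T] _ a])
    show "\<exists>i\<ge>m. winner (rotation_number T i) = \<alpha>" for m \<alpha>
    proof (rule winner_infinitely_often[OF rauzy_path_rotation_number[OF T]])
      show "len (rv_iter T n) $ \<beta> > 0" for n \<beta>
        using rv_iter_rauzy_step[OF T, of n] is_iem_rows(3) by blast
    qed (rule len_rv_iter_Suc[OF T])
  qed
  then show ?thesis
    unfolding roth_type_def restricted_roth_type_def absolute_roth_type_def
      restricted_absolute_roth_type_def
    by blast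
qed

end
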